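(* Let $X$ be a compact metric space, $T\colon X\to X$ a continuous map, and suppose $(X,T)$ is uniquely ergodic with unique $T$-invariant Borel probability measure $\mu$. Then $$\lim_{N\to\infty}\frac1N\sum_{\substack{1\leq n\leq N\\ n\text{ squarefree}}}f\big(T^{\Omega(n)}x\big)=\frac{6}{\pi^2}\left(\int f\,d\mu\right)$$ for every $x\in X$ and every $f\in C(X)$.
   Context: $\Omega(n)$ denotes the number of prime factors of $n$ counted with multiplicities. $C(X)$ is the space of continuous complex-valued functions on $X$. $(X,T)$ is uniquely ergodic if there is exactly one Borel probability measure $\mu$ on $X$ with $\mu(T^{-1}A)=\mu(A)$ for all Borel $A\subset X$. *)

theory Defs
  imports
    "HOL-Probability.Probability"
    "HOL-Computational_Algebra.Computational_Algebra"
begin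

definition num_prime_factors :: "nat \<Rightarrow> nat" where
  "num_prime_factors n = size (prime_factorization n)"

definition invariant_prob_measure :: "('a::topological_space \<Rightarrow> 'a) \<Rightarrow> 'a measure \<Rightarrow> bool" where
  "invariant_prob_measure T M \<longleftrightarrow>
     prob_space M \<and> sets M = sets borel \<and>
     (\<forall>A\<in>sets borel. emeasure M (T -` A) = emeasure M A)"

definition uniquely_ergodic :: "('a::topological_space \<Rightarrow> 'a) \<Rightarrow> bool" where
  "uniquely_ergodic T \<longleftrightarrow> (\<exists>!M. invariant_prob_measure T M)"

end

(*
  The averages of a (num_prime_factors n) and a (num_prime_factors n + 1) over n <= N are
  asymptotically equal for every bounded a (Richter's form of the prime number theorem), so every
  limit point of the empirical measures along T ^^ num_prime_factors n is T-invariant, hence equal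
  to \<mu>.  Sieving with the Moebius function restricts the average to squarefree n.

  For the asymptotic equality, the Turan-Kubilius inequality compares the average at N with the
  shifted averages at N / p.  By Selberg's formula the primes have bounded density on short
  multiplicative intervals; as the averages vary continuously on the logarithmic scale, a long
  excursion would pass through five well separated values, each of which forces most primes into its
  own cells, and there is not enough room.  So the averages are slowly varying, and p can be dropped.
*)

theory Submission
  imports Defs "HOL-Number_Theory.Prime_Powers"
begin

section \<open>The Moebius function and Chebyshev's estimates\<close>

text \<open>For \<open>a k = (-1) ^ k\<close> the asymptotic equality says that the Liouville
  function has mean value zero, a statement equivalent to the prime number theorem, so the estimates
  of Chebyshev and Mertens alone cannot give it. The additional input is one-sided: short
  multiplicative intervals contain at most about twice their expected share of primes, stated below
  with a factor 3 that leaves room for remainders and rounding. The number five comes from this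
  factor. A block of primes has weight about \<open>H\<close>, each separated value claims about 3/4
  of it at least, and all values share about \<open>H / \<delta>\<close> cells of weight at most
  \<open>3 * \<delta>\<close>. Four values would give 3 against 3, five give 15/4 against 3. The
  sieve fits the dynamics because the number of prime factors of \<open>d^2 * m\<close> is additive:
  the sum over multiples of \<open>d^2\<close> is again an orbit average, from another starting
  point, and unique ergodicity gives the same limit from every start.\<close>

definition moebius_mu :: "nat \<Rightarrow> real" where
  "moebius_mu n = (if squarefree n then (-1) ^ card (prime_factors n) else 0)"

lemma abs_moebius_le: "\<bar>moebius_mu n\<bar> \<le> 1"
  by (simp add: moebius_mu_def power_abs)

lemma prime_factors_prod_primes:
  fixes S :: "nat set"
  assumes "finite S" "\<And>p. p \<in> S \<Longrightarrow> prime p"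
  shows "prime_factors (\<Prod>S) = S"
proof -
  have "prime_factorization (\<Prod>S) = mset_set S"
    using assms prime_factorization_prod_mset_primes[of "mset_set S"]
    by (simp add: prod_unfold_prod_mset)
  then show ?thesis using assms by simp
qed

lemma squarefree_prod_primes:
  fixes S :: "nat set"
  assumes "finite S" "\<And>p. p \<in> S \<Longrightarrow> prime p"
  shows "squarefree (\<Prod>S)"
  using assms
proof (induction S)
  case (insert p S)
  have "coprime p (\<Prod>S)"
    using insert by (intro prod_coprime_right) (auto intro!: primes_coprime)
  then show ?case
    using insert by (auto intro: squarefree_mult_coprime squarefree_prime)
qed auto

lemma squarefree_eq_prod_prime_factors:
  fixes d :: nat
  assumes "squarefree d"
  shows "\<Prod>(prime_factors d) = d"
proof -
  have d: "d \<noteq> 0" using assms not_squarefree_0[where 'a = nat] by (intro notI) blast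
  then have "d = (\<Prod>p\<in>prime_factors d. p ^ multiplicity p d)"
    by (simp add: prod_prime_factors)
  also have "\<dots> = \<Prod>(prime_factors d)"
    using assms squarefree_factorial_semiring'[of d] d by (intro prod.cong) auto
  finally show ?thesis by simp
qed

text \<open>Only squarefree divisors count. They correspond to the subsets of the set of prime
  factors, so the sum expands a product of factors \<open>-1 + 1\<close>, which is empty exactly for
  \<open>n = 1\<close>.\<close>

lemma sum_moebius_dvd:
  assumes n: "n > 0"
  shows "(\<Sum>d | d dvd n. moebius_mu d) = (if n = 1 then 1 else 0)"
proof -
  let ?P = "prime_factors n"
  have "(\<Sum>d | d dvd n. moebius_mu d) = (\<Sum>d | d dvd n \<and> squarefree d. moebius_mu d)"
    using n by (intro sum.mono_neutral_right) (auto simp: moebius_mu_def)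
  also have "\<dots> = (\<Sum>S\<in>Pow ?P. (-1) ^ card S)"
  proof (intro sum.reindex_bij_witness[of _ "\<lambda>S. \<Prod>S" prime_factors])
    fix d assume d: "d \<in> {d. d dvd n \<and> squarefree d}"
    then show "\<Prod>(prime_factors d) = d"
      by (auto intro: squarefree_eq_prod_prime_factors)
    show "prime_factors d \<in> Pow ?P"
      using d n by (auto simp: in_prime_factors_iff intro: dvd_trans)
    show "(-1) ^ card (prime_factors d) = moebius_mu d"
      using d by (auto simp: moebius_mu_def)
  next
    fix S assume "S \<in> Pow ?P"
    then have S: "finite S" "\<And>p. p \<in> S \<Longrightarrow> prime p" "\<And>p. p \<in> S \<Longrightarrow> p dvd n"
      by (auto intro: finite_subset)
    have "\<Prod>S dvd n"
      using S
    proof (induction S)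
      case (insert p S)
      have "coprime p (\<Prod>S)"
        using insert by (intro prod_coprime_right) (auto intro!: primes_coprime)
      then show ?case
        using insert by (auto intro: divides_mult)
    qed auto
    then show "\<Prod>S \<in> {d. d dvd n \<and> squarefree d}"
      using S squarefree_prod_primes by auto
    show "prime_factors (\<Prod>S) = S"
      using S prime_factors_prod_primes by blast
  qed
  also have "\<dots> = (\<Prod>p\<in>?P. (-1) + (1::real))"
    by (subst prod_add) auto
  also have "\<dots> = (if n = 1 then 1 else 0)"
  proof -
    have "?P \<noteq> {}" if "n \<noteq> 1"
      using prime_factor_nat[OF that] n by (metis empty_iff in_prime_factors_iff not_gr0)
    then show ?thesis by (auto simp: card_gt_0_iff)
  qed
  finally show ?thesis .
qed

text \<open>Both sides run over the pairs \<open>(d, m)\<close> of positive numbers with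
  \<open>d * m \<le> N\<close>. Dirichlet convolutions are summed up to \<open>N\<close> in this
  form.\<close>

lemma sum_over_divisor_pairs:
  fixes g :: "nat \<Rightarrow> nat \<Rightarrow> 'b::comm_monoid_add"
  shows "(\<Sum>n=1..N. \<Sum>d | d dvd n. g d (n div d)) = (\<Sum>d=1..N. \<Sum>m=1..N div d. g d m)"
proof -
  have "(\<Sum>n=1..N. \<Sum>d | d dvd n. g d (n div d)) =
      (\<Sum>(n,d)\<in>Sigma {1..N} (\<lambda>n. {d. d dvd n}). g d (n div d))"
    by (subst sum.Sigma) auto
  also have "\<dots> = (\<Sum>(d,m)\<in>Sigma {1..N} (\<lambda>d. {1..N div d}). g d m)"
  proof (rule sum.reindex_bij_witness[of _ "\<lambda>(d,m). (d*m, d)" "\<lambda>(n,d). (d, n div d)"])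
    fix q assume "q \<in> Sigma {1..N} (\<lambda>n. {d. d dvd n})"
    then obtain d m where q: "q = (d * m, d)" "d * m \<le> N" "0 < d" "0 < m"
      by (auto elim!: dvdE)
    then have "d \<le> N" by (cases m) auto
    then show "(case q of (n, d) \<Rightarrow> (d, n div d)) \<in> Sigma {1..N} (\<lambda>d. {1..N div d})"
      using q by (simp add: less_eq_div_iff_mult_less_eq mult.commute Suc_le_eq)
  qed (auto simp: less_eq_div_iff_mult_less_eq mult.commute Suc_le_eq)
  also have "\<dots> = (\<Sum>d=1..N. \<Sum>m=1..N div d. g d m)"
    by (subst sum.Sigma) auto
  finally show ?thesis .
qed

text \<open>Moebius inversion of the identity that writes \<open>ln\<close> as a divisor sum of
  \<open>mangoldt\<close>: after exchanging the sums, the Moebius sum over the divisors of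
  \<open>n div e\<close> vanishes unless \<open>e = n\<close>.\<close>

lemma sum_moebius_ln_dvd:
  assumes n: "n > 0"
  shows "(\<Sum>d | d dvd n. moebius_mu d * ln (real n / real d)) = mangoldt n"
proof -
  have "(\<Sum>d | d dvd n. moebius_mu d * ln (real n / real d)) =
      (\<Sum>d | d dvd n. \<Sum>e | e dvd n div d. moebius_mu d * mangoldt e)"
  proof (intro sum.cong refl)
    fix d assume "d \<in> {d. d dvd n}"
    then have "d dvd n" by simp
    then have "ln (real n / real d) = (\<Sum>e | e dvd n div d. mangoldt e)"
      using n mangoldt_sum[of "n div d", where 'a = real] by (auto simp: real_of_nat_div)
    then show "moebius_mu d * ln (real n / real d) = (\<Sum>e | e dvd n div d. moebius_mu d * mangoldt e)"
      by (simp add: sum_distrib_left)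
  qed
  also have "\<dots> = (\<Sum>(d,e)\<in>Sigma {d. d dvd n} (\<lambda>d. {e. e dvd n div d}). moebius_mu d * mangoldt e)"
    using n by (subst sum.Sigma) auto
  also have "\<dots> = (\<Sum>(e,d)\<in>Sigma {e. e dvd n} (\<lambda>e. {d. d dvd n div e}). moebius_mu d * mangoldt e)"
    using n
    by (intro sum.reindex_bij_witness[of _ "\<lambda>(e,d). (d,e)" "\<lambda>(d,e). (e,d)"])
       (auto simp: dvd_div_iff_mult mult.commute elim!: dvdE)
  also have "\<dots> = (\<Sum>e | e dvd n. mangoldt e * (\<Sum>d | d dvd n div e. moebius_mu d))"
    using n by (subst sum.Sigma[symmetric]) (auto simp: sum_distrib_left mult.commute)
  also have "\<dots> = (\<Sum>e | e dvd n. if e = n then mangoldt e else 0)"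
    using n by (intro sum.cong refl) (subst sum_moebius_dvd, auto elim!: dvdE)
  also have "\<dots> = mangoldt n"
    using n by (subst sum.delta) auto
  finally show ?thesis .
qed

section \<open>Chebyshev's function and the first Mertens estimate\<close>

definition chebyshev_psi :: "nat \<Rightarrow> real" where
  "chebyshev_psi N = (\<Sum>n=1..N. mangoldt n)"

lemma chebyshev_psi_mono: "M \<le> N \<Longrightarrow> chebyshev_psi M \<le> chebyshev_psi N"
  unfolding chebyshev_psi_def by (intro sum_mono2) (auto simp: mangoldt_nonneg)

lemma chebyshev_psi_nonneg: "chebyshev_psi N \<ge> 0"
  unfolding chebyshev_psi_def by (intro sum_nonneg) (auto simp: mangoldt_nonneg)

lemma ln_fact_eq_sum: "ln (fact N :: real) = (\<Sum>n=1..N. ln (real n))"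
  by (induction N) (auto simp: ln_mult)

lemma ln_fact_eq_mangoldt: "ln (fact N :: real) = (\<Sum>d=1..N. mangoldt d * real (N div d))"
proof -
  have "ln (fact N :: real) = (\<Sum>n=1..N. \<Sum>d | d dvd n. mangoldt d)"
    unfolding ln_fact_eq_sum using mangoldt_sum[where 'a = real] by (intro sum.cong refl) auto
  also have "\<dots> = (\<Sum>d=1..N. \<Sum>m=1..N div d. mangoldt d)"
    by (rule sum_over_divisor_pairs[of "\<lambda>d m. mangoldt d"])
  finally show ?thesis by (simp add: mult.commute)
qed

lemma ln_fact_eq_psi: "ln (fact N :: real) = (\<Sum>n=1..N. chebyshev_psi (N div n))"
proof -
  have "ln (fact N :: real) = (\<Sum>n=1..N. \<Sum>d | d dvd n. mangoldt d)"
    unfolding ln_fact_eq_sum using mangoldt_sum[where 'a = real] by (intro sum.cong refl) auto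
  also have "\<dots> = (\<Sum>n=1..N. \<Sum>d | d dvd n. mangoldt (n div d) :: real)"
  proof (rule sum.cong[OF refl])
    fix n assume "n \<in> {1..N}"
    then show "(\<Sum>d | d dvd n. mangoldt d :: real) = (\<Sum>d | d dvd n. mangoldt (n div d))"
      by (intro sum.reindex_bij_witness[of _ "\<lambda>d. n div d" "\<lambda>d. n div d"]) auto
  qed
  also have "\<dots> = (\<Sum>n=1..N. chebyshev_psi (N div n))"
    unfolding chebyshev_psi_def by (rule sum_over_divisor_pairs[of "\<lambda>d m. mangoldt m"])
  finally show ?thesis .
qed

lemma ln_Suc_diff_bounds:
  assumes "n \<ge> 1"
  shows "real n * (ln (Suc n) - ln n) \<le> 1" "real (Suc n) * (ln (Suc n) - ln n) \<ge> 1"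
proof -
  have "ln (Suc n) - ln n = ln (real (Suc n) / n)"
    using assms by (subst ln_div) auto
  also have "\<dots> \<le> real (Suc n) / n - 1"
    using assms by (intro ln_le_minus_one) auto
  finally have "real n * (ln (Suc n) - ln n) \<le> real n * (real (Suc n) / n - 1)"
    by (intro mult_left_mono) auto
  then show "real n * (ln (Suc n) - ln n) \<le> 1"
    using assms by (simp add: right_diff_distrib)
  have "ln n - ln (Suc n) = ln (real n / Suc n)"
    using assms by (subst ln_div) auto
  also have "\<dots> \<le> real n / Suc n - 1"
    using assms by (intro ln_le_minus_one) auto
  finally have "real (Suc n) * (ln n - ln (Suc n)) \<le> real (Suc n) * (real n / Suc n - 1)"
    by (intro mult_left_mono) auto
  then have "real (Suc n) * (ln n - ln (Suc n)) \<le> real n - real (Suc n)"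
    by (simp only: right_diff_distrib) simp
  then show "real (Suc n) * (ln (Suc n) - ln n) \<ge> 1"
    by (simp add: algebra_simps)
qed

lemma of_nat_div_bounds:
  shows "real (n div d) \<le> real n / real d" "real n / real d - 1 \<le> real (n div d)"
  using real_of_int_floor_gt_diff_one[of "real n / real d"]
    of_int_floor_le[of "real n / real d"]
  by (simp_all add: floor_divide_of_nat_eq)

lemma ln_fact_bounds:
  assumes "N \<ge> 1"
  shows "real N * ln N - N \<le> ln (fact N)" "ln (fact N) \<le> real N * ln N - N + ln N + 1"
proof -
  have "real N * ln N - N \<le> ln (fact N) \<and> ln (fact N) \<le> real N * ln N - N + ln N + 1"
    using assms
  proof (induction N rule: nat_induct_at_least)
    case (Suc n)
    have "ln (fact (Suc n)) = ln (Suc n) + ln (fact n)"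
      by (simp add: ln_mult)
    moreover have "real (Suc n) * ln (Suc n) = ln (Suc n) + real n * ln (Suc n)"
      by (simp add: algebra_simps)
    ultimately show ?case
      using Suc ln_Suc_diff_bounds[of n] by (simp add: ring_distribs)
  qed auto
  then show "real N * ln N - N \<le> ln (fact N)" "ln (fact N) \<le> real N * ln N - N + ln N + 1"
    by auto
qed

text \<open>Compares \<open>fact N\<close> with the square of \<open>fact (N div 2)\<close>, in the
  manner of the central binomial coefficient. The logarithm of the quotient has
  \<open>mangoldt\<close> coefficients that are nonnegative, and at least 1 beyond
  \<open>N div 2\<close>, while Stirling's bounds make it linear in \<open>N\<close>.\<close>

lemma chebyshev_psi_half:
  assumes "N \<ge> 1"
  shows "chebyshev_psi N \<le> chebyshev_psi (N div 2) + 4 * N"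
proof -
  define M where "M = N div 2"
  let ?c = "\<lambda>d. real (N div d) - 2 * real (M div d)"
  have c: "?c d \<ge> (if M < d then 1 else 0)" if "d \<in> {1..N}" for d
  proof -
    have "2 * (M div d) \<le> (2 * M) div d"
      using that by (simp add: less_eq_div_iff_mult_less_eq)
    also have "\<dots> \<le> N div d"
      by (intro div_le_mono) (simp add: M_def)
    finally have "2 * (M div d) \<le> N div d" .
    moreover have "N div d \<ge> 1" "M div d = 0" if "M < d"
      using that \<open>d \<in> {1..N}\<close> by (auto simp: Suc_le_eq div_greater_zero_iff)
    ultimately show ?thesis by auto
  qed
  have "chebyshev_psi N - chebyshev_psi M = (\<Sum>d\<in>{1..N}. mangoldt d * (if M < d then 1 else 0))"
  proof -
    have "{1..N} = {1..M} \<union> {M<..N}" by (auto simp: M_def)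
    then have "chebyshev_psi N = chebyshev_psi M + (\<Sum>d\<in>{M<..N}. mangoldt d)"
      unfolding chebyshev_psi_def by (simp only:) (intro sum.union_disjoint, auto)
    moreover have "(\<Sum>d\<in>{1..N}. mangoldt d * (if M < d then 1 else 0)) = (\<Sum>d\<in>{M<..N}. mangoldt d :: real)"
      by (intro sum.mono_neutral_cong_right) auto
    ultimately show ?thesis by simp
  qed
  also have "\<dots> \<le> (\<Sum>d\<in>{1..N}. mangoldt d * ?c d)"
    by (intro sum_mono mult_left_mono c mangoldt_nonneg)
  also have "\<dots> = ln (fact N) - 2 * (\<Sum>d\<in>{1..N}. mangoldt d * real (M div d))"
    by (simp add: ln_fact_eq_mangoldt algebra_simps sum_subtractf sum_distrib_left)
  also have "(\<Sum>d\<in>{1..N}. mangoldt d * real (M div d)) = ln (fact M)"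
    unfolding ln_fact_eq_mangoldt by (intro sum.mono_neutral_right) (auto simp: M_def)
  also have "ln (fact N) - 2 * ln (fact M) \<le> 4 * real N"
  proof (cases "M = 0")
    case True
    then have "N = 1" using assms unfolding M_def by linarith
    then show ?thesis using True by simp
  next
    case False
    have 1: "ln (fact N) \<le> real N * ln N - N + ln N + 1"
      using assms by (rule ln_fact_bounds)
    have 2: "ln (fact M) \<ge> real M * ln M - M"
      using False by (intro ln_fact_bounds) auto
    have N: "N \<le> 2 * M + 1" "2 * M \<le> N" unfolding M_def by linarith+
    have "ln N \<le> ln (3 * real M)"
      using assms N False by (intro ln_mono) auto
    also have "\<dots> = ln 3 + ln M"
      using False by (subst ln_mult) auto
    \<comment> \<open>\<open>ln 3 = ln (3/2) + ln 2\<close> is at most \<open>1/2 + 25/36\<close>.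
      The 3 itself comes from \<open>N \<le> 2 * M + 1 \<le> 3 * M\<close>.\<close>
    also have "ln (3::real) \<le> 1.2"
      using ln_le_minus_one[of "3/2::real"] ln_2_less_1 ln_div[of 3 "2::real"] ln2_le_25_over_36
      by simp
    finally have 3: "ln N \<le> 1.2 + ln M" by simp
    have 4: "ln N \<le> real N - 1" using assms by (intro ln_le_minus_one) auto
    have "real N * ln N \<le> (2 * real M + 1) * ln N"
      using N assms by (intro mult_right_mono) auto
    also have "\<dots> = 2 * (real M * ln N) + ln N"
      by (simp add: algebra_simps)
    also have "real M * ln N \<le> real M * (1.2 + ln M)"
      using 3 by (intro mult_left_mono) auto
    finally have 5: "real N * ln N \<le> 2 * (real M * (1.2 + ln M)) + ln N" by simp
    show ?thesis using 1 2 4 5 N by (simp add: algebra_simps)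
  qed
  finally show ?thesis unfolding M_def by simp
qed

lemma chebyshev_psi_le: "chebyshev_psi N \<le> 8 * N"
proof (induction N rule: less_induct)
  case (less N)
  show ?case
  proof (cases "N = 0")
    case False
    then have "chebyshev_psi (N div 2) \<le> 8 * real (N div 2)"
      using less by auto
    moreover have "2 * real (N div 2) \<le> real N"
      by (metis div_times_less_eq_dividend mult.commute of_nat_le_iff of_nat_mult of_nat_numeral)
    ultimately show ?thesis
      using chebyshev_psi_half[of N] False by simp
  qed (auto simp: chebyshev_psi_def)
qed

text \<open>Dropping the floors in the \<open>mangoldt\<close> expansion of
  \<open>ln (fact N)\<close> changes it by at most \<open>chebyshev_psi N \<le> 8 * N\<close>;
  dividing by \<open>N\<close> leaves the constant 8.\<close>

lemma mertens_mangoldt: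
  assumes "N \<ge> 1"
  shows "ln N - 1 \<le> (\<Sum>d=1..N. mangoldt d / d)" "(\<Sum>d=1..N. mangoldt d / d) \<le> ln N + 8"
proof -
  let ?S = "\<Sum>d=1..N. mangoldt d / d :: real"
  have "ln (fact N) \<le> (\<Sum>d=1..N. mangoldt d * (real N / d))"
    unfolding ln_fact_eq_mangoldt
    by (intro sum_mono mult_left_mono mangoldt_nonneg of_nat_div_bounds)
  also have "\<dots> = N * ?S"
    by (simp add: sum_distrib_left mult_ac)
  finally have "N * (ln N - 1) \<le> N * ?S"
    using ln_fact_bounds(1)[OF assms] by (simp add: algebra_simps)
  then show "ln N - 1 \<le> ?S" using assms by simp
  have "N * ?S - chebyshev_psi N = (\<Sum>d=1..N. mangoldt d * (real N / d - 1))"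
    by (simp add: sum_distrib_left mult_ac chebyshev_psi_def sum_subtractf algebra_simps)
  also have "\<dots> \<le> ln (fact N)"
    unfolding ln_fact_eq_mangoldt
    by (intro sum_mono mult_left_mono mangoldt_nonneg of_nat_div_bounds)
  also have "\<dots> \<le> N * ln N"
    unfolding ln_fact_eq_sum using assms by (intro order.trans[OF sum_bounded_above[of _ _ "ln N"]]) auto
  finally have "N * ?S \<le> N * (ln N + 8)"
    using chebyshev_psi_le[of N] by (simp add: algebra_simps)
  then show "?S \<le> ln N + 8" using assms by simp
qed

section \<open>Selberg's formula and primes in short intervals\<close>

lemma sum_inverse_sqrt_le: "(\<Sum>d=1..N. 1 / sqrt (real d)) \<le> 2 * sqrt (real N)"
proof (induction N)
  case (Suc N)
  have "2 * (sqrt (Suc N) * sqrt N) \<le> Suc N + N"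
    using sum_squares_bound[of "sqrt (Suc N)" "sqrt N"] by (simp add: power2_eq_square)
  then have "2 * sqrt N + 1 / sqrt (Suc N) \<le> 2 * sqrt (Suc N)"
    by (simp add: field_simps del: of_nat_Suc) (simp add: algebra_simps)
  then show ?case using Suc by simp
qed simp

text \<open>Trades the squared logarithm in the error of Selberg's formula for a square root, so
  that the sum over \<open>d\<close> is linear in \<open>N\<close> with no logarithm left. The
  fourth root \<open>u\<close> enters through
  \<open>ln t = 4 * ln u \<le> 4 * (u - 1)\<close>.\<close>

lemma ln_mult_ln_le_sqrt:
  fixes t :: real
  assumes "t \<ge> 1"
  shows "ln t * (2 * ln t + 4) \<le> 32 * sqrt t"
proof -
  define u where "u = sqrt (sqrt t)"
  have u: "u \<ge> 1" "sqrt t = u ^ 2" "t = u ^ 4"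
  proof -
    show "u \<ge> 1" using assms by (simp add: u_def)
    show 2: "sqrt t = u ^ 2" using assms by (simp add: u_def)
    have "u ^ 4 = (u ^ 2) ^ 2" by (simp flip: power_mult)
    then show "t = u ^ 4" using assms by (simp add: 2[symmetric])
  qed
  have "ln t = 4 * ln u"
    using u by (simp add: ln_realpow)
  also have "\<dots> \<le> 4 * (u - 1)"
    using u by (intro mult_left_mono ln_le_minus_one) auto
  finally have le: "ln t \<le> 4 * (u - 1)" .
  have "ln t * (2 * ln t + 4) \<le> (4 * (u - 1)) * (2 * (4 * (u - 1)) + 4)"
    using le assms u by (intro mult_mono) auto
  also have "\<dots> \<le> 32 * u ^ 2"
    using u by (simp add: power2_eq_square algebra_simps)
  finally show ?thesis using u by simp
qed

lemma harm_minus_ln_bound: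
  assumes "M \<ge> 1"
  shows "\<bar>harm M - ln M - euler_mascheroni\<bar> \<le> 1 / real M"
proof -
  have "euler_mascheroni \<in> {harm M - ln (Suc M) + inverse (2 * (real M + 1))..
      harm M - ln (Suc M) + inverse (2 * real M)}"
    using euler_mascheroni_bounds[OF assms] by (simp add: add_ac)
  moreover have "ln (Suc M) - ln M \<le> 1 / M"
    using ln_Suc_diff_bounds(1)[OF assms] assms by (simp add: field_simps)
  moreover have "ln M \<le> ln (Suc M)"
    using assms by (intro ln_mono) auto
  moreover have "inverse (2 * (real M + 1)) \<ge> 0" "inverse (2 * real M) \<le> 1 / M"
    using assms by (simp_all add: field_simps)
  ultimately show ?thesis
    by (simp only: atLeastAtMost_iff) linarith
qed

text \<open>The constant \<open>\<gamma> + 1\<close> makes the main terms of \<open>ln (fact M)\<close> and of the harmonic number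
  cancel, so that only a logarithm is left.\<close>

lemma sum_psi_remainder_bound:
  assumes "1 \<le> d" "d \<le> N"
  shows "\<bar>\<Sum>m=1..N div d. chebyshev_psi (N div (d * m)) - real N / real (d * m) + (euler_mascheroni + 1)\<bar>
    \<le> 2 * ln (real N / real d) + 4"
proof -
  define M where "M = N div d"
  define y where "y = real N / real d"
  have M: "M \<ge> 1" using assms by (simp add: M_def Suc_le_eq div_greater_zero_iff)
  have y: "real M \<le> y" "y \<le> real M + 1"
    using of_nat_div_bounds[of N d] by (auto simp: M_def y_def)
  define e1 where "e1 = ln (fact M) - (real M * ln M - M)"
  define e2 where "e2 = harm M - ln M - euler_mascheroni"
  have e1: "\<bar>e1\<bar> \<le> ln M + 1"
    using ln_fact_bounds[OF M] M by (auto simp: e1_def abs_le_iff)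
  have "\<bar>y * e2\<bar> \<le> (real M + 1) * (1 / M)"
    unfolding abs_mult e2_def using harm_minus_ln_bound[OF M] y M by (intro mult_mono) auto
  also have "\<dots> \<le> 2" using M by (simp add: field_simps)
  finally have e2: "\<bar>y * e2\<bar> \<le> 2" .
  have "(\<Sum>m=1..M. chebyshev_psi (N div (d * m)) - real N / real (d * m) + (euler_mascheroni + 1)) =
      (\<Sum>m=1..M. chebyshev_psi (M div m)) - y * harm M + (euler_mascheroni + 1) * M"
  proof -
    have "(\<Sum>m=1..M. chebyshev_psi (N div (d * m)) - real N / real (d * m) + (euler_mascheroni + 1)) =
        (\<Sum>m=1..M. chebyshev_psi (M div m) - y * inverse (of_nat m) + (euler_mascheroni + 1))"
      by (intro sum.cong refl) (simp add: div_mult2_eq M_def y_def divide_inverse)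
    then show ?thesis
      by (simp add: sum.distrib sum_subtractf harm_def sum_distrib_left mult.commute)
  qed
  also have "\<dots> = (M - y) * (ln M + euler_mascheroni) + e1 - y * e2"
    unfolding ln_fact_eq_psi[symmetric] e1_def e2_def by (simp add: algebra_simps)
  also have "\<bar>\<dots>\<bar> \<le> \<bar>(M - y) * (ln M + euler_mascheroni)\<bar> + \<bar>e1\<bar> + \<bar>y * e2\<bar>"
    by linarith
  also have "\<bar>(M - y) * (ln M + euler_mascheroni)\<bar> \<le> 1 * (ln M + 1)"
    unfolding abs_mult using y M euler_mascheroni_pos euler_mascheroni_less_13_over_22
    by (intro mult_mono) auto
  finally have "\<bar>\<Sum>m=1..M. chebyshev_psi (N div (d * m)) - real N / real (d * m) + (euler_mascheroni + 1)\<bar>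
      \<le> 1 * (ln M + 1) + \<bar>e1\<bar> + \<bar>y * e2\<bar>" by simp
  moreover have "ln M \<le> ln y" using y M by (intro ln_mono) auto
  ultimately have "\<bar>\<Sum>m=1..M. chebyshev_psi (N div (d * m)) - real N / real (d * m) + (euler_mascheroni + 1)\<bar>
      \<le> 2 * ln y + 4"
    using e1 e2 by (simp del: of_nat_mult)
  then show ?thesis unfolding M_def y_def .
qed

text \<open>The proof is due to Tatuzawa and Iseki: it applies the Moebius inversion formula weighted by
  a logarithm to the remainder term.\<close>

theorem selberg_formula:
  assumes N: "N \<ge> 1"
  shows "\<bar>chebyshev_psi N * ln N + (\<Sum>n=1..N. mangoldt n * chebyshev_psi (N div n)) - 2 * real N * ln N\<bar> \<le> 90 * real N"
proof -
  define c where "c = (euler_mascheroni + 1 :: real)"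
  define R where "R = (\<lambda>n. chebyshev_psi (N div n) - real N / real n + c)"
  define E where "E = (\<Sum>d=1..N. moebius_mu d * ln (real N / real d) * (\<Sum>m=1..N div d. R (d * m)))"
  have c: "0 \<le> c" "c \<le> 2"
    using euler_mascheroni_pos euler_mascheroni_less_13_over_22 by (auto simp: c_def)
  have "\<bar>E\<bar> \<le> (\<Sum>d=1..N. 32 * (sqrt N * (1 / sqrt d)))"
    unfolding E_def
  proof (intro order.trans[OF sum_abs] sum_mono)
    fix d assume d: "d \<in> {1..N}"
    have ge1: "1 \<le> real N / real d" using d by simp
    have "\<bar>moebius_mu d * ln (real N / real d) * (\<Sum>m=1..N div d. R (d * m))\<bar> \<le>
        1 * ln (real N / real d) * (2 * ln (real N / real d) + 4)"
      unfolding abs_mult R_def c_def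
      using d ge1 abs_moebius_le[of d] sum_psi_remainder_bound[of d N]
      by (intro mult_mono) (auto simp: ln_div)
    also have "\<dots> \<le> 32 * sqrt (real N / real d)"
      using ln_mult_ln_le_sqrt[OF ge1] by simp
    finally show "\<bar>moebius_mu d * ln (real N / real d) * (\<Sum>m=1..N div d. R (d * m))\<bar> \<le>
        32 * (sqrt N * (1 / sqrt d))"
      by (simp add: real_sqrt_divide)
  qed
  also have "\<dots> = 32 * sqrt N * (\<Sum>d=1..N. 1 / sqrt d)"
    by (simp add: sum_distrib_left mult_ac)
  also have "\<dots> \<le> 32 * sqrt N * (2 * sqrt N)"
    by (intro mult_left_mono sum_inverse_sqrt_le) auto
  finally have E: "\<bar>E\<bar> \<le> 64 * N" by simp
  have "E = (\<Sum>n=1..N. \<Sum>d | d dvd n. moebius_mu d * ln (real N / real d) * R (d * (n div d)))"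
    unfolding E_def sum_distrib_left by (rule sum_over_divisor_pairs[symmetric])
  also have "\<dots> = (\<Sum>n=1..N. R n * ((if n = 1 then ln N else 0) + mangoldt n))"
  proof (rule sum.cong[OF refl])
    fix n assume n: "n \<in> {1..N}"
    have "(\<Sum>d | d dvd n. moebius_mu d * ln (real N / real d) * R (d * (n div d))) =
        (\<Sum>d | d dvd n. R n * (ln (real N / real n) * moebius_mu d + moebius_mu d * ln (real n / real d)))"
    proof (rule sum.cong[OF refl])
      fix d assume "d \<in> {d. d dvd n}"
      then have d: "d dvd n" "d > 0" using n by (auto intro: dvd_pos_nat)
      \<comment> \<open>The first summand does not involve \<open>d\<close> and meets a full Moebius
        sum, which survives only at \<open>n = 1\<close>; the second produces
        \<open>mangoldt n\<close>.\<close>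
      have "ln (real N / real d) = ln (real N / real n) + ln (real n / real d)"
        using n d by (simp add: ln_div)
      then show "moebius_mu d * ln (real N / real d) * R (d * (n div d)) =
          R n * (ln (real N / real n) * moebius_mu d + moebius_mu d * ln (real n / real d))"
        using d by (simp add: algebra_simps)
    qed
    also have "\<dots> = R n * (ln (real N / real n) * (\<Sum>d | d dvd n. moebius_mu d) +
        (\<Sum>d | d dvd n. moebius_mu d * ln (real n / real d)))"
      by (simp add: sum_distrib_left sum.distrib distrib_left)
    also have "\<dots> = R n * ((if n = 1 then ln N else 0) + mangoldt n)"
      using n by (simp add: sum_moebius_dvd sum_moebius_ln_dvd)
    finally show "(\<Sum>d | d dvd n. moebius_mu d * ln (real N / real d) * R (d * (n div d))) =
        R n * ((if n = 1 then ln N else 0) + mangoldt n)" .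
  qed
  also have "\<dots> = (\<Sum>n=1..N. if n = 1 then R n * ln N else 0) + (\<Sum>n=1..N. R n * mangoldt n)"
    unfolding sum.distrib[symmetric] by (intro sum.cong) (auto simp: algebra_simps)
  also have "(\<Sum>n=1..N. if n = 1 then R n * ln N else 0) = R 1 * ln N"
    using N by (subst sum.delta) auto
  also have "(\<Sum>n=1..N. R n * mangoldt n) = (\<Sum>n=1..N. mangoldt n * chebyshev_psi (N div n))
      - N * (\<Sum>n=1..N. mangoldt n / n) + c * chebyshev_psi N"
  proof -
    have "(\<Sum>n=1..N. R n * mangoldt n) =
        (\<Sum>n=1..N. mangoldt n * chebyshev_psi (N div n) - N * (mangoldt n / n) + c * mangoldt n)"
      by (intro sum.cong refl) (simp add: R_def algebra_simps)
    then show ?thesis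
      by (simp only: sum.distrib sum_subtractf sum_distrib_left chebyshev_psi_def)
  qed
  \<comment> \<open>The four terms on the right contribute at most 64, 2, 8 and 16 times
    \<open>N\<close>, which add up to the constant 90.\<close>
  finally have "chebyshev_psi N * ln N + (\<Sum>n=1..N. mangoldt n * chebyshev_psi (N div n)) - 2 * real N * ln N =
      E - c * ln N + N * ((\<Sum>n=1..N. mangoldt n / n) - ln N) - c * chebyshev_psi N"
    by (simp add: R_def algebra_simps)
  moreover have "\<bar>c * ln N\<bar> \<le> 2 * real N"
    unfolding abs_mult using c N ln_bound[of "real N"] by (intro mult_mono) auto
  moreover have "\<bar>c * chebyshev_psi N\<bar> \<le> 2 * (8 * real N)"
    unfolding abs_mult using c chebyshev_psi_nonneg[of N] chebyshev_psi_le[of N] by (intro mult_mono) auto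
  moreover have "\<bar>real N * ((\<Sum>n=1..N. mangoldt n / n) - ln N)\<bar> \<le> real N * 8"
    unfolding abs_mult using mertens_mangoldt[OF N] by (intro mult_mono) (auto simp: abs_le_iff)
  ultimately show ?thesis using E by linarith
qed

text \<open>Subtract Selberg's formula at \<open>M\<close> from that at \<open>N\<close>. The
  convolution term increases and can be discarded; this costs a factor 2 over the expected
  \<open>N - M\<close>. The 182 is twice 90, plus 2 for replacing \<open>ln N\<close> by
  \<open>1 + ln M\<close>.\<close>

lemma chebyshev_psi_short_interval:
  assumes "1 \<le> M" "M \<le> N" "N \<le> 2 * M"
  shows "(chebyshev_psi N - chebyshev_psi M) * ln M \<le> 2 * (real N - real M) * ln M + 182 * real N"
proof -
  define S where "S = (\<lambda>N. \<Sum>n=1..N. mangoldt n * chebyshev_psi (N div n))"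
  have "S M \<le> (\<Sum>n=1..M. mangoldt n * chebyshev_psi (N div n))"
    unfolding S_def using assms
    by (intro sum_mono mult_left_mono chebyshev_psi_mono div_le_mono mangoldt_nonneg) auto
  also have "\<dots> \<le> S N"
    unfolding S_def using assms
    by (intro sum_mono2) (auto simp: mangoldt_nonneg chebyshev_psi_nonneg)
  finally have S: "S M \<le> S N" .
  have ln: "ln M \<le> ln N" using assms by (intro ln_mono) auto
  have "ln N \<le> ln (2 * real M)" using assms by (intro ln_mono) auto
  also have "\<dots> = ln 2 + ln M" using assms by (subst ln_mult) auto
  finally have ln2: "ln N \<le> 1 + ln M" using ln_2_less_1 by linarith
  have 1: "chebyshev_psi N * ln M \<le> chebyshev_psi N * ln N"
    using ln by (intro mult_left_mono chebyshev_psi_nonneg)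
  have 2: "\<bar>chebyshev_psi N * ln N + S N - 2 * real N * ln N\<bar> \<le> 90 * real N"
    unfolding S_def using assms by (intro selberg_formula) auto
  have 3: "\<bar>chebyshev_psi M * ln M + S M - 2 * real M * ln M\<bar> \<le> 90 * real M"
    unfolding S_def using assms by (intro selberg_formula) auto
  have 4: "2 * real N * ln N \<le> 2 * real N * (1 + ln M)"
    using ln2 by (intro mult_left_mono) auto
  have "(chebyshev_psi N - chebyshev_psi M) * ln M \<le>
      2 * real N * ln N - 2 * real M * ln M + 90 * real N + 90 * real M"
    using 1 2 3 S by (simp add: algebra_simps)
  also have "\<dots> \<le> 2 * real N * (1 + ln M) - 2 * real M * ln M + 90 * real N + 90 * real N"
    using 4 assms(2) by linarith
  finally show ?thesis by (simp add: algebra_simps)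
qed

section \<open>Passage from prime powers to primes\<close>

lemma mertens_primes:
  "\<exists>c\<ge>0. \<forall>N\<ge>1. \<bar>(\<Sum>p | prime p \<and> p \<le> N. ln (real p) / real p) - ln (real N)\<bar> \<le> c"
proof -
  \<comment> \<open>At a prime \<open>p\<close> this bounds the contribution of all proper powers of
    \<open>p\<close>, by comparison with a geometric series of ratio 1/2. As \<open>g\<close> is
    summable, removing these powers changes the Mertens sum by a bounded amount.\<close>
  define g where "g = (\<lambda>n::nat. 2 * ln (real n) / real n ^ 2)"
  have "summable (\<lambda>n. 4 * real n powr (-3/2))"
    by (intro summable_mult) (simp add: summable_real_powr_iff)
  then have sg: "summable g"
  proof (rule summable_comparison_test'[of _ 1])
    fix n :: nat assume n: "n \<ge> 1"
    have "ln (real n) \<le> real n powr (1/2) / (1/2)"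
      using n by (intro ln_powr_bound) auto
    then have "2 * ln (real n) / real n ^ 2 \<le> 4 * real n powr (1/2) / real n powr 2"
      using n by (simp add: divide_right_mono)
    also have "\<dots> = 4 * real n powr (-3/2)"
      using powr_diff[of "real n" "1/2" 2] by simp
    finally show "norm (g n) \<le> 4 * real n powr (-3/2)"
      using n by (simp add: g_def)
  qed
  have g0: "g n \<ge> 0" for n unfolding g_def by (cases "n = 0") auto
  have "\<bar>(\<Sum>p | prime p \<and> p \<le> N. ln (real p) / real p) - ln (real N)\<bar> \<le> suminf g + 8"
    if N: "N \<ge> 1" for N
  proof -
    define A where "A = {n \<in> {1..N}. primepow n \<and> \<not> prime n}"
    define B where "B = {p. prime p \<and> p \<le> N} \<times> {2..N}"
    have fin: "finite {p. prime p \<and> p \<le> N}" by (rule finite_subset[of _ "{..N}"]) auto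
    have "(\<Sum>n=1..N. mangoldt n / n) = (\<Sum>n\<in>{p. prime p \<and> p \<le> N} \<union> A. mangoldt n / n :: real)"
      by (rule sum.mono_neutral_right)
        (auto simp: A_def mangoldt_def dest: prime_gt_0_nat)
    also have "\<dots> = (\<Sum>p | prime p \<and> p \<le> N. ln (real p) / real p) + (\<Sum>n\<in>A. mangoldt n / n)"
      by (subst sum.union_disjoint) (auto simp: A_def fin)
    finally have eq: "(\<Sum>n=1..N. mangoldt n / n) =
        (\<Sum>p | prime p \<and> p \<le> N. ln (real p) / real p) + (\<Sum>n\<in>A. mangoldt n / n)" .
    have AB: "A \<subseteq> (\<lambda>(p,k). p ^ k) ` B"
    proof
      fix n assume n: "n \<in> A"
      then obtain p k where pk: "prime p" "k > 0" "n = p ^ k"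
        by (auto simp: A_def primepow_def)
      have "k \<noteq> 1" using n pk by (auto simp: A_def)
      have "p \<le> p ^ k" using pk by (intro self_le_power) (auto dest: prime_ge_1_nat)
      moreover have "k \<le> p ^ k"
        using pk prime_ge_2_nat[of p] less_exp[of k] power_mono[of 2 p k] by linarith
      ultimately show "n \<in> (\<lambda>(p,k). p ^ k) ` B"
        using n pk \<open>k \<noteq> 1\<close> by (intro image_eqI[of _ _ "(p, k)"]) (auto simp: A_def B_def)
    qed
    have "(\<Sum>n\<in>A. mangoldt n / n) \<le> (\<Sum>n\<in>(\<lambda>(p,k). p ^ k) ` B. mangoldt n / n :: real)"
      using AB fin by (intro sum_mono2) (auto simp: B_def mangoldt_nonneg)
    also have "\<dots> \<le> (\<Sum>(p,k)\<in>B. mangoldt (p ^ k) / real (p ^ k))"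
      using fin by (intro order.trans[OF sum_image_le]) (auto simp: B_def mangoldt_nonneg case_prod_unfold)
    also have "\<dots> = (\<Sum>p | prime p \<and> p \<le> N. \<Sum>k=2..N. ln p * (1 / p) ^ k)"
      unfolding B_def using fin
      by (subst sum.Sigma[symmetric]) (auto intro!: sum.cong simp: power_divide)
    also have "\<dots> \<le> (\<Sum>p | prime p \<and> p \<le> N. g p)"
    proof (rule sum_mono)
      fix p assume "p \<in> {p. prime p \<and> p \<le> N}"
      then have p: "p \<ge> 2" by (auto dest: prime_ge_2_nat)
      have "(\<Sum>k=2..N. (1 / real p) ^ k) \<le> 2 / real p ^ 2"
      proof -
        have "(\<Sum>k=2..N. (1 / real p) ^ k) \<le> (\<Sum>k\<in>{2..N}. (1 / real p ^ 2) * (1 / 2) ^ (k - 2))"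
        proof (rule sum_mono)
          fix k assume k: "k \<in> {2..N}"
          then have "(1 / real p) ^ k = (1 / real p) ^ 2 * (1 / real p) ^ (k - 2)"
            by (metis atLeastAtMost_iff le_add_diff_inverse power_add)
          also have "\<dots> \<le> (1 / real p) ^ 2 * (1 / 2) ^ (k - 2)"
            using p by (intro mult_left_mono power_mono) (auto simp: field_simps)
          finally show "(1 / real p) ^ k \<le> (1 / real p ^ 2) * (1 / 2) ^ (k - 2)"
            by (simp add: power_divide)
        qed
        also have "\<dots> = (1 / real p ^ 2) * (\<Sum>k\<in>{2..N}. (1 / 2) ^ (k - 2))"
          by (simp add: sum_distrib_left)
        also have "(\<Sum>k\<in>{2..N}. (1 / 2) ^ (k - 2)) = (\<Sum>j<N-1. (1 / 2 :: real) ^ j)"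
          by (rule sum.reindex_bij_witness[of _ "\<lambda>j. j + 2" "\<lambda>k. k - 2"]) auto
        also have "\<dots> \<le> 2"
          by (subst sum_gp_strict) (auto simp: field_simps)
        finally show ?thesis by (simp add: divide_right_mono)
      qed
      then have "ln p * (\<Sum>k=2..N. (1 / real p) ^ k) \<le> ln p * (2 / real p ^ 2)"
        using p by (intro mult_left_mono) auto
      then show "(\<Sum>k=2..N. ln p * (1 / p) ^ k) \<le> g p"
        by (simp add: g_def sum_distrib_left mult_ac)
    qed
    also have "\<dots> \<le> suminf g"
      using g0 by (intro sum_le_suminf sg fin) auto
    finally have "(\<Sum>n\<in>A. mangoldt n / n) \<le> suminf g" .
    moreover have "(\<Sum>n\<in>A. mangoldt n / n :: real) \<ge> 0"
      by (intro sum_nonneg) (auto simp: mangoldt_nonneg)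
    ultimately show ?thesis
      using eq mertens_mangoldt[OF N] by linarith
  qed
  moreover have "suminf g \<ge> 0" using g0 by (intro suminf_nonneg sg)
  ultimately show ?thesis by (intro exI[of _ "suminf g + 8"]) auto
qed

definition primes_between :: "real \<Rightarrow> real \<Rightarrow> nat set" where
  "primes_between u v = {p. prime p \<and> u < real p \<and> real p \<le> v}"

lemma finite_primes_between [simp]: "finite (primes_between u v)"
proof (rule finite_subset)
  show "primes_between u v \<subseteq> {..nat \<lfloor>v\<rfloor>}"
    by (auto simp: primes_between_def le_nat_floor)
qed auto

lemma mertens_primes_between:
  "\<exists>c\<ge>0. \<forall>u v. 1 \<le> u \<longrightarrow> u \<le> v \<longrightarrow>
    \<bar>(\<Sum>p\<in>primes_between u v. ln (real p) / real p) - ln (v / u)\<bar> \<le> c"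
proof -
  obtain c where c: "c \<ge> 0"
    "\<And>N. N \<ge> 1 \<Longrightarrow> \<bar>(\<Sum>p | prime p \<and> p \<le> N. ln (real p) / real p) - ln (real N)\<bar> \<le> c"
    using mertens_primes by blast
  have ln_floor: "\<bar>ln (real (nat \<lfloor>x\<rfloor>)) - ln x\<bar> \<le> 1" if x: "x \<ge> 1" for x :: real
  proof -
    have N: "real (nat \<lfloor>x\<rfloor>) \<ge> 1" "real (nat \<lfloor>x\<rfloor>) \<le> x" "x \<le> 2 * real (nat \<lfloor>x\<rfloor>)"
    proof -
      have "real (nat \<lfloor>x\<rfloor>) = of_int \<lfloor>x\<rfloor>" "1 \<le> \<lfloor>x\<rfloor>" using x by simp_all
      then show "real (nat \<lfloor>x\<rfloor>) \<ge> 1" "real (nat \<lfloor>x\<rfloor>) \<le> x" "x \<le> 2 * real (nat \<lfloor>x\<rfloor>)"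
        by linarith+
    qed
    have "ln x \<le> ln (2 * real (nat \<lfloor>x\<rfloor>))" using N x by (intro ln_mono) auto
    also have "\<dots> = ln 2 + ln (real (nat \<lfloor>x\<rfloor>))" using N by (subst ln_mult) auto
    finally have "ln x \<le> 1 + ln (real (nat \<lfloor>x\<rfloor>))" using ln_2_less_1 by linarith
    moreover have "ln (real (nat \<lfloor>x\<rfloor>)) \<le> ln x" using N by (intro ln_mono) auto
    ultimately show ?thesis by linarith
  qed
  have "\<bar>(\<Sum>p\<in>primes_between u v. ln (real p) / real p) - ln (v / u)\<bar> \<le> 2 * c + 2"
    if uv: "1 \<le> u" "u \<le> v" for u v
  proof -
    define M N where "M = nat \<lfloor>u\<rfloor>" and "N = nat \<lfloor>v\<rfloor>"
    have MN: "M \<ge> 1" "N \<ge> 1" "M \<le> N"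
      using uv unfolding M_def N_def by (linarith, linarith, intro nat_mono floor_mono)
    have iff: "p \<le> M \<longleftrightarrow> real p \<le> u" "p \<le> N \<longleftrightarrow> real p \<le> v" for p
      using uv unfolding M_def N_def by linarith+
    have "{p. prime p \<and> p \<le> N} = {p. prime p \<and> p \<le> M} \<union> primes_between u v"
      using uv by (auto simp: iff primes_between_def)
    then have "(\<Sum>p | prime p \<and> p \<le> N. ln (real p) / real p) =
        (\<Sum>p | prime p \<and> p \<le> M. ln (real p) / real p) + (\<Sum>p\<in>primes_between u v. ln (real p) / real p)"
      by (simp only:) (rule sum.union_disjoint,
        auto simp: iff primes_between_def finite_primes_between[unfolded primes_between_def]
          intro: finite_subset[of _ "{..M}"])
    moreover have "ln (v / u) = ln v - ln u" using uv by (subst ln_div) auto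
    moreover have "v \<ge> 1" using uv by simp
    ultimately show ?thesis
      using c(2)[OF MN(1)] c(2)[OF MN(2)] ln_floor[of u, folded M_def, OF uv(1)] ln_floor[of v, folded N_def]
      by linarith
  qed
  then show ?thesis using c(1) by (intro exI[of _ "2 * c + 2"]) auto
qed

text \<open>The expected weight of the interval is \<open>\<delta>\<close>, and Selberg's formula
  allows twice that. The excess from 2 to 3 pays for \<open>exp \<delta> - 1\<close> being larger
  than \<open>\<delta>\<close>, for the remainder of Selberg's formula and for rounding the
  endpoints.\<close>

lemma primes_between_short:
  assumes "0 < \<delta>" "\<delta> \<le> 1 / 4"
  shows "\<exists>z0\<ge>1. \<forall>z\<ge>z0. (\<Sum>p\<in>primes_between z (exp \<delta> * z). ln (real p) / real p) \<le> 3 * \<delta>"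
proof -
  \<comment> \<open>The main term is \<open>2.5 * \<delta> * z\<close>. The first bound gives
    \<open>ln M \<ge> 1500 / \<delta>\<close>, so the remainder is at most
    \<open>0.182 * \<delta> * z\<close>; the second gives \<open>\<delta> * z \<ge> 16\<close>, so
    the rounding term 2 is below \<open>0.3 * \<delta> * z\<close>.\<close>
  define z0 where "z0 = max (2 * exp (1500 / \<delta>)) (16 / \<delta>)"
  have z0: "z0 \<ge> 16 / \<delta>" "z0 \<ge> 2 * exp (1500 / \<delta>)" "z0 \<ge> 2"
  proof -
    show "z0 \<ge> 2" using assms unfolding z0_def
      by (intro max.coboundedI1) (simp add: one_le_exp_iff)
  qed (simp_all add: z0_def)
  have "(\<Sum>p\<in>primes_between z (exp \<delta> * z). ln (real p) / real p) \<le> 3 * \<delta>" if z: "z \<ge> z0" for z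
  proof -
    have z2: "z \<ge> 2" using z z0 by linarith
    define y where "y = exp \<delta> * z"
    have exp_le: "exp \<delta> \<le> 1 + \<delta> + \<delta>^2" using assms by (intro exp_bound) auto
    have "\<delta>^2 \<le> \<delta> / 4" using assms by (simp add: power2_eq_square)
    then have exp_le': "exp \<delta> \<le> 1 + 5 / 4 * \<delta>" using exp_le by linarith
    have y: "z \<le> y" "y \<le> 3 / 2 * z" "y - z \<le> 5 / 4 * \<delta> * z"
    proof -
      show "z \<le> y" using z2 assms by (simp add: y_def)
      have "y \<le> (1 + 5 / 4 * \<delta>) * z" unfolding y_def using exp_le' z2 by (intro mult_right_mono) auto
      then show "y - z \<le> 5 / 4 * \<delta> * z" by (simp add: algebra_simps)
      moreover have "5 / 4 * \<delta> * z \<le> 1 / 2 * z" using assms z2 by (intro mult_right_mono) auto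
      ultimately show "y \<le> 3 / 2 * z" by linarith
    qed
    define M N where "M = nat \<lfloor>z\<rfloor>" and "N = nat \<lfloor>y\<rfloor>"
    have MN: "1 \<le> M" "M \<le> N" "real M \<ge> z / 2" "real M \<ge> z - 1" "real N \<le> y"
      using y z2 unfolding M_def N_def by (linarith, intro nat_mono floor_mono, linarith+)
    have N2M: "N \<le> 2 * M"
    proof -
      show ?thesis
      proof (cases "M \<ge> 3")
        case True
        have "real N \<le> 3 / 2 * z" "z \<le> real M + 1" using MN y by linarith+
        then have "real N \<le> 2 * real M" using True by linarith
        then show ?thesis by linarith
      next
        case False
        have "real M \<ge> 16 / \<delta> - 1" using z z0 MN by linarith
        moreover have "16 / \<delta> \<ge> 16" using assms by (simp add: field_simps)
        ultimately show ?thesis using False by linarith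
      qed
    qed
    have "exp (1500 / \<delta>) \<le> real M" using z z0 MN by linarith
    then have lnM: "ln M \<ge> 1500 / \<delta>" using MN by (subst ln_ge_iff) auto
    have lnM0: "ln M > 0" using lnM assms by (meson divide_pos_pos less_le_trans zero_less_numeral)
    have iff: "p \<le> M \<longleftrightarrow> real p \<le> z" "p \<le> N \<longleftrightarrow> real p \<le> y" for p
      using z2 y unfolding M_def N_def by linarith+
    let ?S = "\<Sum>p\<in>primes_between z y. ln (real p)"
    have "?S = (\<Sum>p\<in>primes_between z y. mangoldt p)"
      by (intro sum.cong refl) (auto simp: primes_between_def)
    also have "\<dots> \<le> (\<Sum>n\<in>{M<..N}. mangoldt n)"
      by (intro sum_mono2) (auto simp: primes_between_def not_le[symmetric] iff mangoldt_nonneg)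
    also have "\<dots> = chebyshev_psi N - chebyshev_psi M"
    proof -
      have "{1..N} = {1..M} \<union> {M<..N}" using MN by auto
      then show ?thesis
        unfolding chebyshev_psi_def by (simp only:) (subst sum.union_disjoint, auto)
    qed
    also have "\<dots> \<le> 2 * (real N - real M) + 182 * real N / ln M"
      using chebyshev_psi_short_interval[OF MN(1,2) N2M] lnM0 by (simp add: field_simps)
    also have "182 * real N / ln M \<le> 182 * real N / (1500 / \<delta>)"
      using lnM lnM0 assms by (intro divide_left_mono) auto
    also have "\<dots> = (182 / 1500) * \<delta> * N" by simp
    also have "\<dots> \<le> (182 / 1500) * \<delta> * (3 / 2 * z)"
      using MN y assms by (intro mult_left_mono) auto
    also have "2 * (real N - real M) \<le> 2 * (5 / 4 * \<delta> * z + 1)"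
      using MN y by argo
    finally have "?S \<le> 2 * (5 / 4 * \<delta> * z + 1) + 182 / 1500 * \<delta> * (3 / 2 * z)"
      by simp
    then have "?S \<le> 2.7 * (\<delta> * z) + 2"
    proof (rule order.trans)
      have "2 * (5 / 4 * \<delta> * z + 1) + 182 / 1500 * \<delta> * (3 / 2 * z) = 2.682 * (\<delta> * z) + 2"
        by (simp add: field_simps)
      moreover have "0 < \<delta> * z" using assms z2 by simp
      ultimately show "2 * (5 / 4 * \<delta> * z + 1) + 182 / 1500 * \<delta> * (3 / 2 * z) \<le> 2.7 * (\<delta> * z) + 2"
        by simp
    qed
    also have "2 \<le> 0.3 * (\<delta> * z)"
    proof -
      have "16 / \<delta> \<le> z" using z z0(1) by linarith
      then have "16 \<le> \<delta> * z" using assms by (simp add: pos_divide_le_eq mult.commute)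
      then show ?thesis by simp
    qed
    finally have le: "(\<Sum>p\<in>primes_between z y. ln (real p)) \<le> 3 * \<delta> * z" by simp
    have "(\<Sum>p\<in>primes_between z y. ln (real p) / real p) \<le> (\<Sum>p\<in>primes_between z y. ln (real p) / z)"
      using z2 by (intro sum_mono divide_left_mono)
        (auto simp: primes_between_def dest!: prime_ge_1_nat intro!: mult_pos_pos)
    also have "\<dots> \<le> 3 * \<delta>"
      using le z2 by (simp add: sum_divide_distrib[symmetric] field_simps)
    finally show ?thesis by (simp add: y_def)
  qed
  then show ?thesis using z0 by (intro exI[of _ z0]) auto
qed

section \<open>The Turan-Kubilius inequality\<close>

lemma num_prime_factors_mult_prime:
  assumes "prime p" "m > 0"
  shows "num_prime_factors (p * m) = Suc (num_prime_factors m)"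
  using assms by (auto simp: num_prime_factors_def prime_factorization_mult prime_factorization_prime)

lemma sum_of_bool_dvd:
  fixes d :: nat and f :: "nat \<Rightarrow> 'b::semiring_1"
  assumes "d > 0"
  shows "(\<Sum>n=1..N. of_bool (d dvd n) * f n) = (\<Sum>m=1..N div d. f (d * m))"
proof -
  have "(\<Sum>n=1..N. of_bool (d dvd n) * f n) = (\<Sum>n\<in>{n\<in>{1..N}. d dvd n}. f n)"
    by (intro sum.mono_neutral_cong_right) auto
  also have "\<dots> = (\<Sum>m=1..N div d. f (d * m))"
    using assms
    by (intro sum.reindex_bij_witness[of _ "\<lambda>m. d * m" "\<lambda>n. n div d"])
       (auto simp: less_eq_div_iff_mult_less_eq mult.commute Suc_le_eq elim!: dvdE)
  finally show ?thesis .
qed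

text \<open>Divisibility by two distinct primes is independent up to rounding, so after centring
  only floor errors remain. On the diagonal there is in addition the variance, which is at most
  \<open>N / p\<close>.\<close>

lemma prime_dvd_correlation:
  fixes p q :: nat
  assumes "prime p" "prime q"
  shows "\<bar>\<Sum>n=1..N. (of_bool (p dvd n) - 1 / real p) * (of_bool (q dvd n) - 1 / real q)\<bar>
    \<le> (if p = q then real N / p else 0) + 2"
proof -
  define r where "r = (\<lambda>d. real N / real d - real (N div d))"
  have r: "0 \<le> r d" "r d \<le> 1" for d
    using of_nat_div_bounds[of N d] by (auto simp: r_def)
  have pq: "p \<ge> 2" "q \<ge> 2" using assms by (auto dest: prime_ge_2_nat)
  then have pos: "p > 0" "q > 0" by auto
  have count: "(\<Sum>n=1..N. of_bool (d dvd n)) = real (N div d)" if "d > 0" for d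
    using sum_of_bool_dvd[OF that, of "\<lambda>_. 1 :: real" N] by simp
  have "(\<Sum>n=1..N. (of_bool (p dvd n) - 1 / real p) * (of_bool (q dvd n) - 1 / real q)) =
      (\<Sum>n=1..N. of_bool (p dvd n) * of_bool (q dvd n) - of_bool (p dvd n) / q
        - of_bool (q dvd n) / p + 1 / (real p * real q))"
    by (intro sum.cong refl) (simp add: algebra_simps)
  also have "\<dots> = (\<Sum>n=1..N. of_bool (p dvd n) * of_bool (q dvd n)) - real (N div p) / q
      - real (N div q) / p + real N / (real p * real q)"
    by (simp only: sum.distrib sum_subtractf sum_divide_distrib[symmetric] count[OF pos(1)] count[OF pos(2)])
      simp
  also have "\<bar>\<dots>\<bar> \<le> (if p = q then real N / p else 0) + 2"
  proof (cases "p = q")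
    case True
    have eq: "(\<Sum>n=1..N. of_bool (p dvd n) * of_bool (q dvd n) :: real) = real (N div p)"
      using True pq by (subst count[symmetric]) (auto intro!: sum.cong)
    define x y where "x = (real N / p) * (1 - 1 / p)" and "y = r p * (1 - 2 / p)"
    have "x \<le> real N / p * 1" "x \<ge> 0" "y \<le> 1 * 1" "y \<ge> 0"
      using pq r[of p] unfolding x_def y_def
      by (intro mult_left_mono mult_mono mult_nonneg_nonneg; simp add: field_simps)+
    then have "\<bar>x - y\<bar> \<le> real N / p + 2" by linarith
    moreover have "real (N div p) - real (N div p) / p - real (N div p) / p + real N / (real p * real p) = x - y"
      using pq by (simp add: x_def y_def r_def field_simps)
    ultimately show ?thesis using True eq by simp
  next
    case False
    then have "coprime p q" using assms primes_coprime by blast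
    then have "p dvd n \<and> q dvd n \<longleftrightarrow> p * q dvd n" for n
      by (meson divides_mult dvd_mult_left dvd_mult_right)
    then have "(\<Sum>n=1..N. of_bool (p dvd n) * of_bool (q dvd n) :: real) = (\<Sum>n=1..N. of_bool (p * q dvd n))"
      by (intro sum.cong refl) (simp flip: of_bool_conj)
    also have "\<dots> = real (N div (p * q))"
      using pq by (intro count) auto
    finally have "(\<Sum>n=1..N. of_bool (p dvd n) * of_bool (q dvd n) :: real) = real (N div (p * q))" .
    then have "(\<Sum>n=1..N. of_bool (p dvd n) * of_bool (q dvd n)) - real (N div p) / q
        - real (N div q) / p + real N / (real p * real q) = r p / q + r q / p - r (p * q)"
      using pq by (simp add: r_def field_simps)
    moreover have "r p / q \<le> 1 / 1" "r q / p \<le> 1 / 1" "r p / q \<ge> 0" "r q / p \<ge> 0"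
      using r[of p] r[of q] pq by (intro frac_le divide_nonneg_nonneg; simp)+
    ultimately show ?thesis using False r[of "p * q"] by simp
  qed
  finally show ?thesis .
qed

text \<open>Expanding the square gives one correlation for each pair of primes: the diagonal yields
  the sum of \<open>1 / p\<close>, and rounding costs 2 per pair. The weights allow signs to be
  inserted.\<close>

lemma turan_kubilius_weighted:
  fixes P :: "nat set"
  assumes P: "finite P" "\<And>p. p \<in> P \<Longrightarrow> prime p" and w: "\<And>p. \<bar>w p\<bar> \<le> 1"
  shows "(\<Sum>n=1..N. (\<Sum>p\<in>P. w p * (of_bool (p dvd n) - 1 / real p))\<^sup>2)
    \<le> real N * (\<Sum>p\<in>P. 1 / real p) + 2 * (real (card P))\<^sup>2"
proof -
  let ?h = "\<lambda>p n. of_bool (p dvd n) - 1 / real p"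
  have "(\<Sum>n=1..N. (\<Sum>p\<in>P. w p * ?h p n)\<^sup>2) =
      (\<Sum>n=1..N. \<Sum>p\<in>P. \<Sum>q\<in>P. w p * w q * (?h p n * ?h q n))"
    by (simp add: power2_eq_square sum_product mult_ac)
  also have "\<dots> = (\<Sum>p\<in>P. \<Sum>n=1..N. \<Sum>q\<in>P. w p * w q * (?h p n * ?h q n))"
    by (rule sum.swap)
  also have "\<dots> = (\<Sum>p\<in>P. \<Sum>q\<in>P. w p * w q * (\<Sum>n=1..N. ?h p n * ?h q n))"
    by (subst sum.swap) (simp add: sum_distrib_left)
  also have "\<dots> \<le> (\<Sum>p\<in>P. \<Sum>q\<in>P. (if p = q then real N / p else 0) + 2)"
  proof (intro sum_mono)
    fix p q assume pq: "p \<in> P" "q \<in> P"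
    have "w p * w q * (\<Sum>n=1..N. ?h p n * ?h q n) \<le> \<bar>w p * w q\<bar> * \<bar>\<Sum>n=1..N. ?h p n * ?h q n\<bar>"
      unfolding abs_mult[symmetric] by (rule abs_ge_self)
    also have "\<dots> \<le> 1 * ((if p = q then real N / p else 0) + 2)"
    proof (rule mult_mono)
      show "\<bar>w p * w q\<bar> \<le> 1"
        unfolding abs_mult using w[of p] w[of q] by (simp add: mult_le_one)
    qed (use prime_dvd_correlation[of p q N] P pq in auto)
    finally show "w p * w q * (\<Sum>n=1..N. ?h p n * ?h q n) \<le> (if p = q then real N / p else 0) + 2"
      by simp
  qed
  also have "\<dots> = real N * (\<Sum>p\<in>P. 1 / real p) + 2 * (real (card P))\<^sup>2"
    using P by (simp add: sum.distrib sum_distrib_left power2_eq_square)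
  finally show ?thesis .
qed

section \<open>Averages of a function of the number of prime factors\<close>

definition omega_sum :: "(nat \<Rightarrow> real) \<Rightarrow> nat \<Rightarrow> real" where
  "omega_sum a N = (\<Sum>n=1..N. a (num_prime_factors n))"

text \<open>Normalising by the real \<open>y\<close> and not by its floor makes the average at
  \<open>N / p\<close> an exact multiple of \<open>omega_sum a (N div p)\<close>.\<close>

definition omega_mean :: "(nat \<Rightarrow> real) \<Rightarrow> real \<Rightarrow> real" where
  "omega_mean a y = omega_sum a (nat \<lfloor>y\<rfloor>) / y"

lemma omega_mean_of_nat: "omega_mean a (real N) = omega_sum a N / real N"
  by (simp add: omega_mean_def)

lemma omega_mean_divide:
  assumes "p > 0" "N > 0"
  shows "omega_mean a (real N / real p) / real p = omega_sum a (N div p) / real N"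
proof -
  have "nat \<lfloor>real N / real p\<rfloor> = N div p" by (simp add: floor_divide_of_nat_eq)
  then show ?thesis using assms by (simp add: omega_mean_def)
qed

text \<open>Multiplication by \<open>p\<close> adds one prime factor, so the shifted sum up to
  \<open>N div p\<close> is the sum of \<open>a (num_prime_factors n)\<close> over the multiples
  \<open>n\<close> of \<open>p\<close>. Each deviation is thus a correlation with
  \<open>of_bool (p dvd n) - 1 / p\<close>, to which Cauchy-Schwarz and the variance bound apply.
  The gain is the square root: the trivial bound is twice the sum of \<open>1 / p\<close>.\<close>

lemma omega_mean_prime_shift:
  assumes P: "finite P" "\<And>p. p \<in> P \<Longrightarrow> prime p"
    and a: "\<And>k. \<bar>a k\<bar> \<le> 1"
    and N: "N > 0" "2 * (real (card P))\<^sup>2 \<le> real N * (\<Sum>p\<in>P. 1 / real p)"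
  shows "(\<Sum>p\<in>P. \<bar>omega_mean (\<lambda>k. a (Suc k)) (real N / real p) - omega_mean a (real N)\<bar> / real p)
    \<le> sqrt (2 * (\<Sum>p\<in>P. 1 / real p))"
proof -
  define L where "L = (\<Sum>p\<in>P. 1 / real p)"
  define D where "D = (\<lambda>p. omega_sum (\<lambda>k. a (Suc k)) (N div p) - omega_sum a N / real p)"
  \<comment> \<open>The signs turn the sum of absolute values into a single bilinear sum, in which
    the order of summation can be exchanged.\<close>
  define w where "w = (\<lambda>p. sgn (D p))"
  have p0: "p > 0" if "p \<in> P" for p using P(2)[OF that] by (simp add: prime_gt_0_nat)
  have Dsum: "D p = (\<Sum>n=1..N. a (num_prime_factors n) * (of_bool (p dvd n) - 1 / real p))"
    if p: "p \<in> P" for p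
  proof -
    have "omega_sum (\<lambda>k. a (Suc k)) (N div p) = (\<Sum>m=1..N div p. a (num_prime_factors (p * m)))"
      unfolding omega_sum_def using P(2)[OF p]
      by (intro sum.cong refl) (simp add: num_prime_factors_mult_prime)
    also have "\<dots> = (\<Sum>n=1..N. of_bool (p dvd n) * a (num_prime_factors n))"
      by (rule sum_of_bool_dvd[OF p0[OF p], symmetric])
    finally show ?thesis
      by (simp add: D_def omega_sum_def algebra_simps sum_subtractf sum_divide_distrib)
  qed
  have "(\<Sum>p\<in>P. \<bar>D p\<bar>) = (\<Sum>p\<in>P. w p * D p)"
    by (simp add: w_def abs_sgn mult.commute)
  also have "\<dots> = (\<Sum>p\<in>P. \<Sum>n=1..N. a (num_prime_factors n) * (w p * (of_bool (p dvd n) - 1 / real p)))"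
    by (intro sum.cong refl) (simp add: Dsum sum_distrib_left mult_ac)
  also have "\<dots> = (\<Sum>n=1..N. a (num_prime_factors n) * (\<Sum>p\<in>P. w p * (of_bool (p dvd n) - 1 / real p)))"
    by (subst sum.swap) (simp add: sum_distrib_left)
  finally have eq: "(\<Sum>p\<in>P. \<bar>D p\<bar>) =
      (\<Sum>n=1..N. a (num_prime_factors n) * (\<Sum>p\<in>P. w p * (of_bool (p dvd n) - 1 / real p)))" .
  have "(\<Sum>p\<in>P. \<bar>D p\<bar>)\<^sup>2 \<le> (\<Sum>n=1..N. (a (num_prime_factors n))\<^sup>2) *
      (\<Sum>n=1..N. (\<Sum>p\<in>P. w p * (of_bool (p dvd n) - 1 / real p))\<^sup>2)"
    unfolding eq by (rule Cauchy_Schwarz_ineq_sum)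
  also have "\<dots> \<le> real N * (real N * L + 2 * (real (card P))\<^sup>2)"
  proof (rule mult_mono)
    have "(\<Sum>n=1..N. (a (num_prime_factors n))\<^sup>2) \<le> (\<Sum>n=1..N. 1)"
      using a by (intro sum_mono) (auto simp: abs_square_le_1)
    then show "(\<Sum>n=1..N. (a (num_prime_factors n))\<^sup>2) \<le> real N" by simp
    show "(\<Sum>n=1..N. (\<Sum>p\<in>P. w p * (of_bool (p dvd n) - 1 / real p))\<^sup>2) \<le> real N * L + 2 * (real (card P))\<^sup>2"
      unfolding L_def by (rule turan_kubilius_weighted[OF P]) (auto simp: w_def sgn_if)
  qed (auto intro: sum_nonneg)
  also have "\<dots> \<le> real N * (real N * L + real N * L)"
    using N by (intro mult_left_mono add_left_mono) (auto simp: L_def)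
  also have "\<dots> = (real N)\<^sup>2 * (2 * L)"
    by (simp add: power2_eq_square algebra_simps)
  finally have "(\<Sum>p\<in>P. \<bar>D p\<bar>) \<le> sqrt ((real N)\<^sup>2 * (2 * L))"
    by (rule real_le_rsqrt)
  then have "(\<Sum>p\<in>P. \<bar>D p\<bar>) / real N \<le> sqrt (2 * L)"
    using N by (simp add: real_sqrt_mult field_simps)
  moreover have "\<bar>omega_mean (\<lambda>k. a (Suc k)) (real N / real p) - omega_mean a (real N)\<bar> / real p = \<bar>D p\<bar> / real N"
    if p: "p \<in> P" for p
  proof -
    have "\<bar>omega_mean (\<lambda>k. a (Suc k)) (real N / real p) - omega_mean a (real N)\<bar> / real p =
        \<bar>omega_mean (\<lambda>k. a (Suc k)) (real N / real p) / real p - omega_mean a (real N) / real p\<bar>"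
      using p0[OF p] by (simp flip: diff_divide_distrib)
    also have "omega_mean (\<lambda>k. a (Suc k)) (real N / real p) / real p - omega_mean a (real N) / real p = D p / real N"
      using omega_mean_divide[OF p0[OF p] N(1), of "\<lambda>k. a (Suc k)"]
      by (simp add: omega_mean_of_nat D_def diff_divide_distrib mult.commute)
    also have "\<bar>D p / real N\<bar> = \<bar>D p\<bar> / real N" by simp
    finally show ?thesis .
  qed
  ultimately show ?thesis
    by (simp add: L_def sum_divide_distrib)
qed

lemma abs_omega_sum_le:
  assumes "\<And>k. \<bar>a k\<bar> \<le> 1"
  shows "\<bar>omega_sum a N\<bar> \<le> real N"
  unfolding omega_sum_def
  using assms by (intro order.trans[OF sum_abs] order.trans[OF sum_bounded_above[of _ _ 1]]) auto

text \<open>One \<open>1 - y / y'\<close> accounts for the added terms, the other for the change of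
  normalisation, and \<open>1 / y'\<close> for rounding the endpoints.\<close>

lemma omega_mean_lipschitz:
  assumes a: "\<And>k. \<bar>a k\<bar> \<le> 1" and y: "0 < y" "y \<le> y'"
  shows "\<bar>omega_mean a y' - omega_mean a y\<bar> \<le> 2 * (1 - y / y') + 1 / y'"
proof -
  define M N where "M = nat \<lfloor>y\<rfloor>" and "N = nat \<lfloor>y'\<rfloor>"
  have M: "real M = of_int \<lfloor>y\<rfloor>" and N: "real N = of_int \<lfloor>y'\<rfloor>"
    using y by (simp_all add: M_def N_def)
  have MN: "M \<le> N" using y by (auto simp: M_def N_def intro: nat_mono floor_mono)
  have diff: "\<bar>omega_sum a N - omega_sum a M\<bar> \<le> y' - y + 1"
  proof -
    have "{1..N} = {1..M} \<union> {M<..N}" using MN by auto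
    then have "omega_sum a N = omega_sum a M + (\<Sum>n\<in>{M<..N}. a (num_prime_factors n))"
      unfolding omega_sum_def by (simp only:) (rule sum.union_disjoint, auto)
    moreover have "\<bar>\<Sum>n\<in>{M<..N}. a (num_prime_factors n)\<bar> \<le> (\<Sum>n\<in>{M<..N}. 1)"
      using a by (intro order.trans[OF sum_abs] sum_mono) auto
    moreover have "(\<Sum>n\<in>{M<..N}. 1) = real N - real M" using MN by simp
    ultimately show ?thesis using M N by linarith
  qed
  have "\<bar>omega_sum a M\<bar> \<le> real M" by (rule abs_omega_sum_le[OF a])
  also have "real M \<le> y" using M by linarith
  finally have M_le: "\<bar>omega_sum a M\<bar> \<le> y" .
  have "omega_mean a y' - omega_mean a y =
      (omega_sum a N - omega_sum a M) / y' - omega_sum a M * (1 / y - 1 / y')"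
    using y by (simp add: omega_mean_def M_def N_def field_simps)
  also have "\<bar>\<dots>\<bar> \<le> \<bar>(omega_sum a N - omega_sum a M) / y'\<bar> + \<bar>omega_sum a M * (1 / y - 1 / y')\<bar>"
    by (rule abs_triangle_ineq4)
  also have "\<bar>(omega_sum a N - omega_sum a M) / y'\<bar> \<le> (y' - y + 1) / y'"
    using diff y by (simp add: divide_right_mono)
  also have "\<bar>omega_sum a M * (1 / y - 1 / y')\<bar> \<le> y * (1 / y - 1 / y')"
    unfolding abs_mult using M_le y by (intro mult_mono) (auto simp: frac_le)
  also have "(y' - y + 1) / y' + y * (1 / y - 1 / y') = 2 * (1 - y / y') + 1 / y'"
    using y by (simp add: field_simps)
  finally show ?thesis by simp
qed

section \<open>Slow variation of the averages\<close>

text \<open>The primes with logarithm in \<open>(H, 2 * H]\<close>. Their total weight is about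
  \<open>H\<close> for \<open>ln p / p\<close>, and for \<open>1 / p\<close> it lies between
  positive constants independent of \<open>H\<close>, so that estimates for one weight transfer to
  the other.\<close>

definition prime_block :: "real \<Rightarrow> nat set" where
  "prime_block H = primes_between (exp H) (exp (2 * H))"

lemma finite_prime_block [simp]: "finite (prime_block H)"
  by (simp add: prime_block_def)

lemma prime_blockD:
  assumes "p \<in> prime_block H"
  shows "prime p" "exp H < real p" "real p \<le> exp (2 * H)" "H < ln (real p)" "ln (real p) \<le> 2 * H" "p > 0"
proof -
  show p: "prime p" "exp H < real p" "real p \<le> exp (2 * H)"
    using assms by (auto simp: prime_block_def primes_between_def)
  show "p > 0" using p(1) by (rule prime_gt_0_nat)
  then show "H < ln (real p)" "ln (real p) \<le> 2 * H"
    using p by (metis exp_less_cancel_iff exp_ln of_nat_0_less_iff, metis exp_le_cancel_iff exp_ln of_nat_0_less_iff)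
qed

text \<open>Mertens' estimate settles the weight \<open>ln p / p\<close>, and
  \<open>H < ln p \<le> 2 * H\<close> passes to \<open>1 / p\<close>. The restriction
  \<open>H \<ge> 2 * c\<close> keeps the Mertens error below \<open>H / 2\<close>.\<close>

lemma prime_block_sums:
  "\<exists>c\<ge>1. \<forall>H\<ge>2 * c. H - c \<le> (\<Sum>p\<in>prime_block H. ln (real p) / real p) \<and>
     1 / 4 \<le> (\<Sum>p\<in>prime_block H. 1 / real p) \<and> (\<Sum>p\<in>prime_block H. 1 / real p) \<le> 2"
proof -
  obtain c where c: "c \<ge> 0" "\<And>u v. 1 \<le> u \<Longrightarrow> u \<le> v \<Longrightarrow>
    \<bar>(\<Sum>p\<in>primes_between u v. ln (real p) / real p) - ln (v / u)\<bar> \<le> c"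
    using mertens_primes_between by blast
  have "H - (c + 1) \<le> (\<Sum>p\<in>prime_block H. ln (real p) / real p) \<and>
     1 / 4 \<le> (\<Sum>p\<in>prime_block H. 1 / real p) \<and> (\<Sum>p\<in>prime_block H. 1 / real p) \<le> 2"
    if H: "H \<ge> 2 * (c + 1)" for H
  proof -
    let ?S = "\<Sum>p\<in>prime_block H. ln (real p) / real p"
    let ?L = "\<Sum>p\<in>prime_block H. 1 / real p"
    have H0: "H > 0" using H c(1) by argo
    have "ln (exp (2 * H) / exp H) = H"
      by (simp flip: exp_diff)
    then have S: "\<bar>?S - H\<bar> \<le> c"
      using c(2)[of "exp H" "exp (2 * H)"] H0 by (simp add: prime_block_def)
    have "H * ?L \<le> ?S"
      unfolding sum_distrib_left
      by (intro sum_mono) (auto intro!: divide_right_mono less_imp_le[OF prime_blockD(4)])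
    moreover have "?S \<le> 2 * H * ?L"
      unfolding sum_distrib_left
      by (intro sum_mono) (auto intro!: divide_right_mono prime_blockD(5))
    moreover have "?S \<le> H * 2" "?S \<ge> H / 2" using S H c(1) by argo+
    ultimately have "H * ?L \<le> H * 2" "H * (1 / 4) \<le> H * ?L" by linarith+
    then show ?thesis using H0 S by auto
  qed
  then show ?thesis using c(1) by (intro exI[of _ "c + 1"]) auto
qed

text \<open>Five sequences cannot all be sampled at most primes of a block without two of them meeting in
  the same cell of length \<open>\<delta>\<close> on the logarithmic scale, since by the sieve bound a cell has at most three
  times its expected share of primes.\<close>

lemma five_separated_values_contradiction:
  fixes A :: "real \<Rightarrow> real" and v x :: "nat \<Rightarrow> real"
  assumes \<delta>: "0 < \<delta>" and N: "0 < N" and R: "1 \<le> R" and H: "0 < H" and \<eta>: "0 < \<eta>"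
    and cell: "\<And>z. z \<ge> exp (H - \<delta>) \<Longrightarrow> (\<Sum>p\<in>primes_between z (exp \<delta> * z). ln (real p) / real p) \<le> 3 * \<delta>"
    and mass: "H - c \<le> (\<Sum>p\<in>prime_block H. ln (real p) / real p)"
    and lip: "\<And>y y'. N / exp (2 * H) \<le> y \<Longrightarrow> N / exp (2 * H) \<le> y' \<Longrightarrow> \<bar>ln y - ln y'\<bar> \<le> \<delta> \<Longrightarrow> \<bar>A y - A y'\<bar> \<le> \<eta>"
    and x: "\<And>i. i < 5 \<Longrightarrow> N \<le> x i \<and> x i \<le> R * N"
    and sep: "\<And>i j. i < 5 \<Longrightarrow> j < 5 \<Longrightarrow> i \<noteq> j \<Longrightarrow> \<bar>v i - v j\<bar> > 3 * \<eta>"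
    and small: "\<And>i. i < 5 \<Longrightarrow> (\<Sum>p\<in>prime_block H. \<bar>A (x i / real p) - v i\<bar> / real p) \<le> \<eta> / 8"
    and large: "5 * c + 3 * ln R + 6 * \<delta> < 3 / 4 * H"
  shows False
proof -
  let ?B = "prime_block H"
  let ?w = "\<lambda>p. ln (real p) / real p"
  \<comment> \<open>\<open>G i\<close> holds the primes at which the sample is close to
    \<open>v i\<close>; \<open>cl i p\<close> numbers the cell containing
    \<open>ln (x i / p)\<close>, and \<open>C i\<close> is the set of cells hit by primes of
    \<open>G i\<close>.\<close>
  define G where "G = (\<lambda>i. {p \<in> ?B. \<bar>A (x i / real p) - v i\<bar> \<le> \<eta>})"
  define cl where "cl = (\<lambda>i p. \<lfloor>ln (x i / real p) / \<delta>\<rfloor>)"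
  define C where "C = (\<lambda>i. cl i ` G i)"
  have fG: "finite (G i)" "finite (C i)" for i by (simp_all add: G_def C_def)
  have x0: "x i > 0" if "i < 5" for i using x[OF that] N by linarith
  have wpos: "?w p \<ge> 0" if "p \<in> ?B" for p
    using prime_blockD[OF that] H by (intro divide_nonneg_nonneg) auto
  \<comment> \<open>Markov's inequality: the exceptional primes have weight at most 1/8 for
    \<open>1 / p\<close>, hence at most \<open>2 * H / 8\<close> for
    \<open>ln p / p\<close>.\<close>
  have lower: "3 / 4 * H - c \<le> (\<Sum>p\<in>G i. ?w p)" if i: "i < 5" for i
  proof -
    have "\<eta> * (\<Sum>p\<in>?B - G i. 1 / real p) = (\<Sum>p\<in>?B - G i. \<eta> / real p)"
      by (simp add: sum_distrib_left)
    also have "\<dots> \<le> (\<Sum>p\<in>?B - G i. \<bar>A (x i / real p) - v i\<bar> / real p)"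
      by (intro sum_mono divide_right_mono) (auto simp: G_def)
    also have "\<dots> \<le> (\<Sum>p\<in>?B. \<bar>A (x i / real p) - v i\<bar> / real p)"
      by (intro sum_mono2) auto
    also have "\<dots> \<le> \<eta> * (1 / 8)" using small[OF i] by simp
    finally have 1: "(\<Sum>p\<in>?B - G i. 1 / real p) \<le> 1 / 8"
      using \<eta> by (simp add: mult_le_cancel_left)
    have "(\<Sum>p\<in>?B - G i. ?w p) \<le> (\<Sum>p\<in>?B - G i. 2 * H * (1 / real p))"
      by (intro sum_mono) (auto intro!: divide_right_mono prime_blockD(5))
    also have "\<dots> = 2 * H * (\<Sum>p\<in>?B - G i. 1 / real p)"
      by (simp add: sum_distrib_left)
    also have "\<dots> \<le> 2 * H * (1 / 8)" using 1 H by (intro mult_left_mono) auto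
    finally have "(\<Sum>p\<in>?B - G i. ?w p) \<le> H / 4" by simp
    moreover have "(\<Sum>p\<in>?B. ?w p) = (\<Sum>p\<in>?B - G i. ?w p) + (\<Sum>p\<in>G i. ?w p)"
      by (rule sum.subset_diff) (auto simp: G_def)
    ultimately show ?thesis using mass by linarith
  qed
  have upper: "(\<Sum>p\<in>G i. ?w p) \<le> 3 * \<delta> * real (card (C i))" if i: "i < 5" for i
  proof -
    have "(\<Sum>p\<in>G i. ?w p) = (\<Sum>k\<in>C i. \<Sum>p\<in>{p \<in> G i. cl i p = k}. ?w p)"
      using fG by (intro sum.group[symmetric]) (auto simp: C_def)
    also have "\<dots> \<le> (\<Sum>k\<in>C i. 3 * \<delta>)"
    proof (rule sum_mono)
      fix k assume "k \<in> C i"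
      then obtain q where q: "q \<in> G i" "cl i q = k" by (auto simp: C_def)
      \<comment> \<open>For fixed \<open>i\<close>, a cell of \<open>ln (x i / p)\<close>
        corresponds to a multiplicative interval for \<open>p\<close>; the floor makes it open at
        \<open>z\<close> and closed at \<open>exp \<delta> * z\<close>.\<close>
      define z where "z = x i / exp (\<delta> * (of_int k + 1))"
      have z0: "z > 0" using x0[OF i] by (simp add: z_def)
      have ez: "exp \<delta> * z = x i / exp (\<delta> * of_int k)"
        by (simp add: z_def distrib_left exp_add)
      have in_cell: "z < real p \<and> real p \<le> exp \<delta> * z" if p: "p \<in> G i" "cl i p = k" for p
      proof -
        have p0: "real p > 0" using p prime_blockD(6)[of p H] by (auto simp: G_def)
        have "of_int k \<le> ln (x i / real p) / \<delta>" "ln (x i / real p) / \<delta> < of_int k + 1"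
          using p(2) by (auto simp: cl_def floor_eq_iff)
        then have "\<delta> * of_int k \<le> ln (x i / real p)" "ln (x i / real p) < \<delta> * (of_int k + 1)"
          using \<delta> by (simp_all add: field_simps)
        then have "exp (\<delta> * of_int k) \<le> x i / real p" "x i / real p < exp (\<delta> * (of_int k + 1))"
          using x0[OF i] p0 by (metis divide_pos_pos exp_le_cancel_iff exp_ln,
            metis divide_pos_pos exp_less_cancel_iff exp_ln)
        then show ?thesis
          unfolding ez unfolding z_def using p0
            by (simp add: pos_divide_less_eq pos_le_divide_eq mult.commute)
      qed
      have "exp H < real q" using q prime_blockD(2)[of q H] by (auto simp: G_def)
      also have "\<dots> \<le> exp \<delta> * z" using in_cell[OF q] by simp
      finally have "exp (H - \<delta>) \<le> z" by (simp add: exp_diff field_simps)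
      then have "(\<Sum>p\<in>primes_between z (exp \<delta> * z). ?w p) \<le> 3 * \<delta>" by (rule cell)
      moreover have "(\<Sum>p\<in>{p \<in> G i. cl i p = k}. ?w p) \<le> (\<Sum>p\<in>primes_between z (exp \<delta> * z). ?w p)"
      proof (rule sum_mono2)
        show "{p \<in> G i. cl i p = k} \<subseteq> primes_between z (exp \<delta> * z)"
          using in_cell prime_blockD(1) by (auto simp: primes_between_def G_def)
        show "?w p \<ge> 0" if "p \<in> primes_between z (exp \<delta> * z) - {p \<in> G i. cl i p = k}" for p
          using that by (auto simp: primes_between_def dest!: prime_ge_1_nat)
      qed simp
      ultimately show "(\<Sum>p\<in>{p \<in> G i. cl i p = k}. ?w p) \<le> 3 * \<delta>" by linarith
    qed
    finally show ?thesis by (simp add: mult.commute)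
  qed
  have yN: "N / exp (2 * H) \<le> x i / real p" if "i < 5" "p \<in> ?B" for i p
    using x[OF that(1)] prime_blockD(3,6)[OF that(2)] N by (intro frac_le) auto
  \<comment> \<open>A common cell would bring \<open>v i\<close> and \<open>v j\<close> within
    \<open>3 * \<eta>\<close>: one \<open>\<eta>\<close> for each sample and one for the variation
    of \<open>A\<close> across the cell.\<close>
  have disj: "C i \<inter> C j = {}" if ij: "i < 5" "j < 5" "i \<noteq> j" for i j
  proof (rule ccontr)
    assume "C i \<inter> C j \<noteq> {}"
    then obtain p q where pq: "p \<in> G i" "q \<in> G j" "cl i p = cl j q" by (auto simp: C_def)
    have "\<bar>ln (x i / real p) / \<delta> - ln (x j / real q) / \<delta>\<bar> \<le> 1"
      using pq(3) unfolding cl_def by linarith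
    then have "\<bar>ln (x i / real p) - ln (x j / real q)\<bar> \<le> \<delta>"
      using \<delta> by (simp add: abs_le_iff field_simps)
    then have "\<bar>A (x i / real p) - A (x j / real q)\<bar> \<le> \<eta>"
      using pq ij by (intro lip yN) (auto simp: G_def)
    then have "\<bar>v i - v j\<bar> \<le> 3 * \<eta>"
      using pq by (simp add: G_def abs_le_iff)
    then show False using sep[OF ij] by linarith
  qed
  \<comment> \<open>All the logarithms of \<open>x i / p\<close> lie in one interval of length
    \<open>H + ln R\<close>, which limits the number of cells shared by the five sequences.\<close>
  define K1 K2 where "K1 = \<lfloor>(ln N - 2 * H) / \<delta>\<rfloor>" and "K2 = \<lfloor>(ln N + ln R - H) / \<delta>\<rfloor>"
  have C_sub: "C i \<subseteq> {K1..K2}" if i: "i < 5" for i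
  proof
    fix k assume "k \<in> C i"
    then obtain p where p: "p \<in> ?B" "k = cl i p" by (auto simp: C_def G_def)
    have ln_eq: "ln (x i / real p) = ln (x i) - ln (real p)"
      using x0[OF i] prime_blockD(6)[OF p(1)] by (subst ln_div) auto
    have "ln N \<le> ln (x i)" using x[OF i] N by (intro ln_mono) auto
    moreover have "ln (x i) \<le> ln (R * N)" using x[OF i] x0[OF i] by (intro ln_mono) auto
    moreover have "ln (R * N) = ln R + ln N" using N R by (subst ln_mult) auto
    ultimately have "ln N - 2 * H \<le> ln (x i / real p)" "ln (x i / real p) \<le> ln N + ln R - H"
      using prime_blockD(4,5)[OF p(1)] ln_eq by linarith+
    then show "k \<in> {K1..K2}"
      unfolding p(2) cl_def K1_def K2_def using \<delta> by (auto intro!: floor_mono divide_right_mono)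
  qed
  have "(\<Sum>i<5. card (C i)) = card (\<Union>i\<in>{..<5}. C i)"
    using fG disj by (intro card_UN_disjoint[symmetric]) auto
  also have "\<dots> \<le> card {K1..K2}"
    using C_sub by (intro card_mono) auto
  finally have "real (\<Sum>i<5. card (C i)) \<le> real (card {K1..K2})" by (simp only: of_nat_le_iff)
  also have "\<dots> \<le> (ln N + ln R - H) / \<delta> - (ln N - 2 * H) / \<delta> + 2"
  proof -
    have "K1 \<le> K2"
      unfolding K1_def K2_def using \<delta> H R by (intro floor_mono divide_right_mono) auto
    then have "real (card {K1..K2}) = of_int K2 - of_int K1 + 1" by simp
    moreover have "of_int K2 \<le> (ln N + ln R - H) / \<delta>" "(ln N - 2 * H) / \<delta> \<le> of_int K1 + 1"
      unfolding K1_def K2_def by linarith+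
    ultimately show ?thesis by linarith
  qed
  also have "\<dots> = (H + ln R) / \<delta> + 2"
    by (simp add: diff_divide_distrib add_divide_distrib)
  finally have card: "real (\<Sum>i<5. card (C i)) \<le> (H + ln R) / \<delta> + 2" .
  \<comment> \<open>The weights claimed exceed the weight available by
    \<open>(15/4 - 3) * H\<close>, which is the \<open>3 / 4 * H\<close> that \<open>large\<close>
    sets against the lower-order terms.\<close>
  have "5 * (3 / 4 * H - c) = (\<Sum>i<5::nat. 3 / 4 * H - c)" by simp
  also have "\<dots> \<le> (\<Sum>i<5. 3 * \<delta> * real (card (C i)))"
    using lower upper by (intro sum_mono) (meson lessThan_iff order.trans)
  also have "\<dots> = 3 * \<delta> * real (\<Sum>i<5. card (C i))"
    by (simp add: sum_distrib_left)
  also have "\<dots> \<le> 3 * \<delta> * ((H + ln R) / \<delta> + 2)"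
    using card \<delta> by (intro mult_left_mono) auto
  also have "\<dots> = 3 * H + 3 * ln R + 6 * \<delta>"
    using \<delta> by (simp add: field_simps)
  finally show False using large by argo
qed

lemma omega_mean_cell:
  assumes a: "\<And>k. \<bar>a k\<bar> \<le> 1" and y: "y > 0" "y' > 0" and ln: "\<bar>ln y - ln y'\<bar> \<le> \<delta>"
    and y0: "y0 \<le> y" "y0 \<le> y'" "y0 > 0"
  shows "\<bar>omega_mean a y - omega_mean a y'\<bar> \<le> 2 * \<delta> + 1 / y0"
proof -
  have *: "\<bar>omega_mean a y' - omega_mean a y\<bar> \<le> 2 * \<delta> + 1 / y0"
    if "y > 0" "y \<le> y'" "ln y' - ln y \<le> \<delta>" "y0 \<le> y" for y y'
  proof -
    have "ln (y / y') \<le> y / y' - 1" using that by (intro ln_le_minus_one) auto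
    moreover have "ln (y / y') = ln y - ln y'" using that by (subst ln_div) auto
    ultimately have "1 - y / y' \<le> \<delta>" using that by linarith
    moreover have "1 / y' \<le> 1 / y0" using that y0(3) by (intro frac_le) auto
    ultimately show ?thesis using omega_mean_lipschitz[of a y y', OF a] that by force
  qed
  show ?thesis
  proof (cases "y \<le> y'")
    case True
    then show ?thesis using *[of y y'] y ln y0 by (simp add: abs_minus_commute abs_le_iff)
  next
    case False
    then show ?thesis using *[of y' y] y ln y0 by (simp add: abs_minus_commute abs_le_iff)
  qed
qed

lemma prime_block_disjoint:
  assumes "2 * H \<le> H'"
  shows "prime_block H \<inter> prime_block H' = {}"
  using assms prime_blockD(4)[of _ H'] prime_blockD(5)[of _ H] by force

text \<open>Doubling \<open>H\<close> makes consecutive blocks adjacent and disjoint. For large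
  \<open>H\<close> each has \<open>1 / p\<close> weight of constant order, so the total is of order
  \<open>m\<close>, against a deviation bound of order \<open>sqrt m\<close>.\<close>

definition prime_blocks :: "real \<Rightarrow> nat \<Rightarrow> nat set" where
  "prime_blocks H m = (\<Union>r<m. prime_block (2 ^ r * H))"

lemma finite_prime_blocks [simp]: "finite (prime_blocks H m)"
  by (simp add: prime_blocks_def)

lemma prime_prime_blocks: "p \<in> prime_blocks H m \<Longrightarrow> prime p"
  by (auto simp: prime_blocks_def dest: prime_blockD)

lemma sum_prime_blocks:
  assumes "H > 0"
  shows "sum f (prime_blocks H m) = (\<Sum>r<m. sum f (prime_block (2 ^ r * H)))"
  unfolding prime_blocks_def
proof (rule sum.UNION_disjoint)
  have *: "prime_block (2 ^ r * H) \<inter> prime_block (2 ^ s * H) = {}" if "r < s" for r s :: nat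
  proof (rule prime_block_disjoint)
    have "(2::real) ^ Suc r \<le> 2 ^ s" using that by (intro power_increasing) auto
    then show "2 * (2 ^ r * H) \<le> 2 ^ s * H" using assms by (simp add: mult_right_mono)
  qed
  show "\<forall>i\<in>{..<m}. \<forall>j\<in>{..<m}. i \<noteq> j \<longrightarrow> prime_block (2 ^ i * H) \<inter> prime_block (2 ^ j * H) = {}"
  proof (intro ballI impI)
    fix i j :: nat assume "i \<noteq> j"
    then show "prime_block (2 ^ i * H) \<inter> prime_block (2 ^ j * H) = {}"
      using *[of i j] *[of j i] by (cases i j rule: linorder_cases) auto
  qed
qed auto

text \<open>The rounding term of the variance bound is negligible once the finite set of primes is
  fixed and \<open>N\<close> grows.\<close>

lemma eventually_card_square_le:
  assumes "finite P" "\<And>p. p \<in> P \<Longrightarrow> prime p"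
  shows "eventually (\<lambda>N. 2 * (real (card P))\<^sup>2 \<le> real N * (\<Sum>p\<in>P. 1 / real p)) sequentially"
proof (cases "P = {}")
  case False
  define L where "L = (\<Sum>p\<in>P. 1 / real p)"
  have "L > 0"
    unfolding L_def using assms False by (intro sum_pos) (auto dest: prime_gt_0_nat)
  have "eventually (\<lambda>N. N \<ge> nat \<lceil>2 * (real (card P))\<^sup>2 / L\<rceil>) sequentially"
    by (rule eventually_ge_at_top)
  then show ?thesis
  proof eventually_elim
    case (elim N)
    then have "2 * (real (card P))\<^sup>2 / L \<le> real N" by linarith
    then show ?case using \<open>L > 0\<close> by (simp add: L_def field_simps)
  qed
qed simp

text \<open>A pigeonhole argument over blocks: the five sequences together deviate by at most
  \<open>10 * sqrt m\<close> over \<open>m\<close> disjoint blocks, so for large \<open>m\<close>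
  one block is good for all five at once, as the count of cells requires.\<close>

lemma omega_mean_not_separated:
  assumes a: "\<And>k. \<bar>a k\<bar> \<le> 1" and \<eta>: "0 < \<eta>" "\<eta> \<le> 1" and R: "1 \<le> R"
  shows "eventually (\<lambda>N. \<not> (\<exists>n::nat \<Rightarrow> nat. (\<forall>i<5. N \<le> n i \<and> real (n i) \<le> R * real N) \<and>
    (\<forall>i<5. \<forall>j<5. i \<noteq> j \<longrightarrow> \<bar>omega_mean a (real (n i)) - omega_mean a (real (n j))\<bar> > 3 * \<eta>))) sequentially"
proof -
  define a' where "a' = (\<lambda>k. a (Suc k))"
  have a': "\<bar>a' k\<bar> \<le> 1" for k using a by (simp add: a'_def)
  obtain c where c: "c \<ge> 1" "\<And>H. H \<ge> 2 * c \<Longrightarrow> H - c \<le> (\<Sum>p\<in>prime_block H. ln (real p) / real p)"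
      "\<And>H. H \<ge> 2 * c \<Longrightarrow> (\<Sum>p\<in>prime_block H. 1 / real p) \<le> 2"
    using prime_block_sums by blast
  \<comment> \<open>Across a cell the shifted mean varies by at most
    \<open>2 * \<delta> = \<eta> / 2\<close> plus a rounding term, which the choice of
    \<open>Y\<close> keeps below \<open>\<eta> / 2\<close>.\<close>
  define \<delta> where "\<delta> = \<eta> / 4"
  have \<delta>: "0 < \<delta>" "\<delta> \<le> 1 / 4" using \<eta> by (auto simp: \<delta>_def)
  obtain z0 where z0: "z0 \<ge> 1"
    "\<And>z. z \<ge> z0 \<Longrightarrow> (\<Sum>p\<in>primes_between z (exp \<delta> * z). ln (real p) / real p) \<le> 3 * \<delta>"
    using primes_between_short[OF \<delta>] by blast
  \<comment> \<open>Chosen so that every \<open>H \<ge> H0\<close> satisfies the block estimates,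
    puts the cells beyond \<open>z0\<close>, and gives
    \<open>5 * c + 3 * ln R + 6 * \<delta> < 3 / 4 * H\<close>.\<close>
  define H0 where "H0 = 8 * c + 4 * ln R + ln z0 + 3"
  have lnR: "ln R \<ge> 0" and lnz: "ln z0 \<ge> 0" using R z0 by auto
  \<comment> \<open>With \<open>sqrt m \<ge> 80 / \<eta>\<close> the total
    \<open>10 * sqrt m\<close> is at most \<open>m * \<eta> / 8\<close>, so some block deviates by
    no more than \<open>\<eta> / 8\<close>.\<close>
  define m where "m = nat \<lceil>(80 / \<eta>)\<^sup>2\<rceil>"
  have m: "(80 / \<eta>)\<^sup>2 \<le> real m" unfolding m_def by linarith
  have "0 < (80 / \<eta>)\<^sup>2" using \<eta> by simp
  then have m0: "m > 0" using m by (intro Nat.gr0I) auto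
  define H where "H = (\<lambda>r. 2 ^ r * H0)"
  have H0: "H0 > 0" using c(1) lnR lnz by (simp add: H0_def)
  have H_ge: "H r \<ge> H0" for r
    unfolding H_def using H0 by simp
  define P where "P = prime_blocks H0 m"
  define L where "L = (\<Sum>p\<in>P. 1 / real p)"
  have "L = (\<Sum>r<m. \<Sum>p\<in>prime_block (H r). 1 / real p)"
    unfolding L_def P_def H_def by (rule sum_prime_blocks[OF H0])
  also have "\<dots> \<le> (\<Sum>r<m. 2)"
  proof (intro sum_mono c(3))
    fix r show "2 * c \<le> H r" using H_ge[of r] c(1) lnR lnz by (simp add: H0_def)
  qed
  finally have L: "L \<le> 2 * real m" by simp
  define Y where "Y = 2 / \<eta> * exp (2 * H m)"
  have ev: "eventually (\<lambda>N. N \<ge> nat \<lceil>Y\<rceil> \<and> N > 0) sequentially"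
    by (intro eventually_conj eventually_ge_at_top eventually_gt_at_top)
  have "eventually (\<lambda>N. \<forall>M\<ge>N. 2 * (real (card P))\<^sup>2 \<le> real M * L) sequentially"
    using eventually_card_square_le[of P] unfolding L_def P_def
    by (intro eventually_all_ge_at_top) (auto dest: prime_prime_blocks)
  then show ?thesis using ev
  proof eventually_elim
    case (elim N)
    then have N: "N > 0" "Y \<le> real N" by (auto simp: nat_ceiling_le_eq)
    show ?case
    proof (intro notI, elim exE conjE)
      fix n :: "nat \<Rightarrow> nat"
      assume n: "\<forall>i<5. N \<le> n i \<and> real (n i) \<le> R * real N"
        and sep: "\<forall>i<5. \<forall>j<5. i \<noteq> j \<longrightarrow> \<bar>omega_mean a (real (n i)) - omega_mean a (real (n j))\<bar> > 3 * \<eta>"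
      define d where "d = (\<lambda>i p. \<bar>omega_mean a' (real (n i) / real p) - omega_mean a (real (n i))\<bar> / real p)"
      have d0: "d i p \<ge> 0" for i p by (simp add: d_def)
      have tk: "(\<Sum>p\<in>P. d i p) \<le> 2 * sqrt (real m)" if i: "i < 5" for i
      proof -
        have ni: "N \<le> n i" using n i by simp
        have "(\<Sum>p\<in>P. d i p) \<le> sqrt (2 * L)"
          unfolding d_def L_def a'_def
        proof (rule omega_mean_prime_shift[OF _ _ a])
          show "2 * (real (card P))\<^sup>2 \<le> real (n i) * (\<Sum>p\<in>P. 1 / real p)"
            using elim(1) ni unfolding L_def by simp
          show "0 < n i" using ni N(1) by simp
        qed (auto simp: P_def dest: prime_prime_blocks)
        also have "\<dots> \<le> sqrt (4 * real m)" using L by simp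
        finally show ?thesis by (simp add: real_sqrt_mult)
      qed
      have "\<exists>r<m. (\<Sum>i<5. \<Sum>p\<in>prime_block (H r). d i p) \<le> \<eta> / 8"
      proof (rule ccontr)
        assume neg: "\<not> (\<exists>r<m. (\<Sum>i<5. \<Sum>p\<in>prime_block (H r). d i p) \<le> \<eta> / 8)"
        have "(\<Sum>r<m. \<eta> / 8) < (\<Sum>r<m. \<Sum>i<5. \<Sum>p\<in>prime_block (H r). d i p)"
        proof (rule sum_strict_mono)
          show "\<eta> / 8 < (\<Sum>i<5. \<Sum>p\<in>prime_block (H r). d i p)" if "r \<in> {..<m}" for r
            using neg that by (simp add: not_le)
        qed (use m0 in auto)
        then have lt: "m * (\<eta> / 8) < (\<Sum>r<m. \<Sum>i<5. \<Sum>p\<in>prime_block (H r). d i p)"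
          by simp
        have "(\<Sum>r<m. \<Sum>i<5. \<Sum>p\<in>prime_block (H r). d i p) = (\<Sum>i<5. \<Sum>p\<in>P. d i p)"
          by (subst sum.swap) (simp add: P_def sum_prime_blocks[OF H0] H_def)
        also have "\<dots> \<le> (\<Sum>i<5::nat. 2 * sqrt (real m))"
          by (intro sum_mono tk) auto
        finally have "m * (\<eta> / 8) < 10 * sqrt (real m)" using lt by simp
        moreover have "sqrt (real m) * (sqrt (real m) * (\<eta> / 8)) = m * (\<eta> / 8)"
          by (subst mult.assoc[symmetric]) simp
        ultimately have "sqrt (real m) * (sqrt (real m) * (\<eta> / 8)) < sqrt (real m) * 10"
          by (simp only: mult.commute[of 10])
        then have "sqrt (real m) * (\<eta> / 8) < 10"
          using m0 by (subst (asm) mult_less_cancel_left_pos) auto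
        then have "sqrt (real m) < 80 / \<eta>"
          using \<eta> by (simp add: field_simps)
        moreover have "80 / \<eta> \<le> sqrt (real m)"
          using m \<eta> by (intro real_le_rsqrt)
        ultimately show False by simp
      qed
      then obtain r where r: "r < m" "(\<Sum>i<5. \<Sum>p\<in>prime_block (H r). d i p) \<le> \<eta> / 8" by blast
      have Hr: "H0 \<le> H r" "0 < H r" using H_ge[of r] H0 by auto
      have "H r \<le> H m" unfolding H_def using r H0 by (simp add: power_increasing)
      then have "Y \<ge> 2 / \<eta> * exp (2 * H r)"
        unfolding Y_def using \<eta> by (intro mult_left_mono) auto
      then have "2 / \<eta> * exp (2 * H r) \<le> real N" using N by linarith
      then have y0: "2 / \<eta> \<le> real N / exp (2 * H r)" by (simp add: pos_le_divide_eq)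
      define y0 where "y0 = real N / exp (2 * H r)"
      have y0_pos: "y0 > 0" using N by (simp add: y0_def)
      have inv_y0: "1 / y0 \<le> \<eta> / 2"
        using y0 \<eta> y0_pos unfolding y0_def[symmetric] by (simp add: field_simps)
      show False
      proof (rule five_separated_values_contradiction[where \<delta> = \<delta> and N = "real N" and R = R and H = "H r"
            and \<eta> = \<eta> and c = c and A = "omega_mean a'" and x = "\<lambda>i. real (n i)"
            and v = "\<lambda>i. omega_mean a (real (n i))"])
        fix z assume "exp (H r - \<delta>) \<le> z"
        moreover have "z0 \<le> exp (H r - \<delta>)"
        proof -
          have "ln z0 \<le> H r - \<delta>" using Hr c(1) lnR \<delta> unfolding H0_def by linarith
          then have "exp (ln z0) \<le> exp (H r - \<delta>)" by simp
          then show ?thesis using z0(1) by simp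
        qed
        ultimately show "(\<Sum>p\<in>primes_between z (exp \<delta> * z). ln (real p) / real p) \<le> 3 * \<delta>"
          by (intro z0(2)) auto
      next
        show "H r - c \<le> (\<Sum>p\<in>prime_block (H r). ln (real p) / real p)"
          using Hr c(1) lnR lnz unfolding H0_def by (intro c(2)) auto
      next
        fix y y' assume "real N / exp (2 * H r) \<le> y" "real N / exp (2 * H r) \<le> y'" "\<bar>ln y - ln y'\<bar> \<le> \<delta>"
        then have "\<bar>omega_mean a' y - omega_mean a' y'\<bar> \<le> 2 * \<delta> + 1 / y0"
          using y0_pos unfolding y0_def[symmetric] by (intro omega_mean_cell[OF a']) auto
        also have "\<dots> \<le> \<eta>" using inv_y0 by (simp add: \<delta>_def)
        finally show "\<bar>omega_mean a' y - omega_mean a' y'\<bar> \<le> \<eta>" .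
      next
        fix i :: nat assume i: "i < 5"
        have "(\<Sum>p\<in>prime_block (H r). d i p) \<le> (\<Sum>i<5. \<Sum>p\<in>prime_block (H r). d i p)"
          using i d0 by (intro member_le_sum) (auto intro: sum_nonneg)
        then show "(\<Sum>p\<in>prime_block (H r). \<bar>omega_mean a' (real (n i) / real p) - omega_mean a (real (n i))\<bar> / real p) \<le> \<eta> / 8"
          using r(2) unfolding d_def by linarith
      next
        show "5 * c + 3 * ln R + 6 * \<delta> < 3 / 4 * H r"
          using Hr c(1) lnR lnz \<delta> unfolding H0_def by linarith
      next
        fix i j :: nat assume "i < 5" "j < 5" "i \<noteq> j"
        then show "3 * \<eta> < \<bar>omega_mean a (real (n i)) - omega_mean a (real (n j))\<bar>"
          using sep by blast
      next
        fix i :: nat assume "i < 5"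
        then show "real N \<le> real (n i) \<and> real (n i) \<le> R * real N"
          using n by simp
      qed (use \<delta> N(1) R Hr \<eta> in simp_all)
    qed
  qed
qed

text \<open>A discrete intermediate value argument: the five levels
  \<open>F N + i * \<epsilon> / 4\<close>, from \<open>i = 0\<close> to \<open>i = 4\<close>, are
  all reached by the time \<open>M\<close>, and the first index reaching a level overshoots it by at
  most one step \<open>s\<close>.\<close>

lemma five_separated_points:
  fixes F :: "nat \<Rightarrow> real"
  assumes MN: "N \<le> M" and jump: "F N + \<epsilon> < F M" and \<epsilon>: "0 < \<epsilon>"
    and step: "\<And>k. N \<le> k \<Longrightarrow> \<bar>F (Suc k) - F k\<bar> \<le> s" and s: "0 \<le> s"
  shows "\<exists>n::nat \<Rightarrow> nat. (\<forall>i<5. N \<le> n i \<and> n i \<le> M) \<and>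
    (\<forall>i<5. \<forall>j<5. i \<noteq> j \<longrightarrow> \<epsilon> / 4 - s \<le> \<bar>F (n i) - F (n j)\<bar>)"
proof -
  define v where "v = (\<lambda>i::nat. F N + real i * (\<epsilon> / 4))"
  define n where "n = (\<lambda>i. LEAST k. N \<le> k \<and> v i \<le> F k)"
  have n: "N \<le> n i \<and> v i \<le> F (n i) \<and> n i \<le> M \<and> F (n i) \<le> v i + s" if i: "i < 5" for i
  proof -
    have "real i * (\<epsilon> / 4) \<le> 4 * (\<epsilon> / 4)"
      using i \<epsilon> by (intro mult_right_mono) auto
    then have M: "N \<le> M \<and> v i \<le> F M" using MN jump by (simp add: v_def)
    have 1: "N \<le> n i \<and> v i \<le> F (n i)"
      unfolding n_def by (rule LeastI[of _ M]) (rule M)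
    have 2: "n i \<le> M"
      unfolding n_def by (rule Least_le) (rule M)
    have "F (n i) \<le> v i + s"
    proof (cases "n i = N")
      case True
      have "v i \<ge> F N" using \<epsilon> by (simp add: v_def)
      then show ?thesis using True s by simp
    next
      case False
      then obtain k where k: "n i = Suc k" "N \<le> k" using 1 by (cases "n i") auto
      have "\<not> (N \<le> k \<and> v i \<le> F k)"
        using not_less_Least[of k "\<lambda>k. N \<le> k \<and> v i \<le> F k"] k(1) by (simp add: n_def)
      then show ?thesis using k step[of k] by auto
    qed
    then show ?thesis using 1 2 by blast
  qed
  have sep: "\<epsilon> / 4 - s \<le> F (n j) - F (n i)" if "i < j" "j < 5" for i j
  proof -
    have "1 * (\<epsilon> / 4) \<le> (real j - real i) * (\<epsilon> / 4)"
      using that \<epsilon> by (intro mult_right_mono) auto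
    then have "v j \<ge> v i + \<epsilon> / 4" by (simp add: v_def left_diff_distrib)
    then show ?thesis using n[of i] n[of j] that by simp
  qed
  have "\<epsilon> / 4 - s \<le> \<bar>F (n i) - F (n j)\<bar>" if "i < 5" "j < 5" "i \<noteq> j" for i j
    using sep[of i j] sep[of j i] that by (cases i j rule: linorder_cases) auto
  then show ?thesis using n by blast
qed

lemma omega_mean_slowly_varying:
  assumes a: "\<And>k. \<bar>a k\<bar> \<le> 1" and \<epsilon>: "0 < \<epsilon>" and R: "1 \<le> R"
  shows "eventually (\<lambda>N. \<forall>M. N \<le> M \<longrightarrow> real M \<le> R * real N \<longrightarrow>
    \<bar>omega_mean a (real M) - omega_mean a (real N)\<bar> \<le> \<epsilon>) sequentially"
proof -
  \<comment> \<open>The five levels are \<open>\<epsilon> / 4 \<ge> 4 * \<eta>\<close> apart; the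
    step size \<open>3 / N\<close> takes less than one \<open>\<eta>\<close>, so more than
    \<open>3 * \<eta>\<close> remains.\<close>
  define \<eta> where "\<eta> = min 1 (\<epsilon> / 16)"
  have \<eta>: "0 < \<eta>" "\<eta> \<le> 1" "16 * \<eta> \<le> \<epsilon>" using \<epsilon> by (auto simp: \<eta>_def)
  have "eventually (\<lambda>N. N \<ge> nat \<lceil>4 / \<eta>\<rceil> \<and> N > 0) sequentially"
    by (intro eventually_conj eventually_ge_at_top eventually_gt_at_top)
  with omega_mean_not_separated[of a \<eta> R, OF a \<eta>(1,2) R] show ?thesis
  proof eventually_elim
    case (elim N)
    then have N: "N > 0" "4 / \<eta> \<le> real N" by (auto simp: nat_ceiling_le_eq)
    then have s: "3 / real N < \<eta>" using \<eta>(1) by (simp add: field_simps)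
    let ?A = "\<lambda>n. omega_mean a (real n)"
    have step: "\<bar>?A (Suc k) - ?A k\<bar> \<le> 3 / real N" if k: "N \<le> k" for k
    proof -
      have "\<bar>?A (Suc k) - ?A k\<bar> \<le> 2 * (1 - real k / real (Suc k)) + 1 / real (Suc k)"
        using k N by (intro omega_mean_lipschitz[OF a]) auto
      also have "\<dots> = 3 / real (Suc k)" by (simp add: field_simps)
      also have "\<dots> \<le> 3 / real N" using k N by (intro divide_left_mono) auto
      finally show ?thesis .
    qed
    show ?case
    proof (intro allI impI, rule ccontr)
      fix M assume M: "N \<le> M" "real M \<le> R * real N" and gt: "\<not> \<bar>?A M - ?A N\<bar> \<le> \<epsilon>"
      have "\<exists>n::nat \<Rightarrow> nat. (\<forall>i<5. N \<le> n i \<and> n i \<le> M) \<and>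
        (\<forall>i<5. \<forall>j<5. i \<noteq> j \<longrightarrow> \<epsilon> / 4 - 3 / real N \<le> \<bar>?A (n i) - ?A (n j)\<bar>)"
      proof (cases "?A N + \<epsilon> < ?A M")
        case True
        then show ?thesis by (intro five_separated_points M \<epsilon> step) auto
      next
        case False
        \<comment> \<open>A drop of the averages is a rise of their negatives.\<close>
        then have "- ?A N + \<epsilon> < - ?A M" using gt by linarith
        then have "\<exists>n::nat \<Rightarrow> nat. (\<forall>i<5. N \<le> n i \<and> n i \<le> M) \<and>
          (\<forall>i<5. \<forall>j<5. i \<noteq> j \<longrightarrow> \<epsilon> / 4 - 3 / real N \<le> \<bar>- ?A (n i) - - ?A (n j)\<bar>)"
          using step by (intro five_separated_points M \<epsilon>) (auto simp: abs_minus_commute)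
        then show ?thesis by (simp add: abs_minus_commute)
      qed
      then obtain n :: "nat \<Rightarrow> nat" where n: "\<forall>i<5. N \<le> n i \<and> n i \<le> M"
        "\<forall>i<5. \<forall>j<5. i \<noteq> j \<longrightarrow> \<epsilon> / 4 - 3 / real N \<le> \<bar>?A (n i) - ?A (n j)\<bar>"
        by (elim exE conjE)
      have "N \<le> n i \<and> real (n i) \<le> R * real N" if "i < 5" for i
        using n(1)[rule_format, OF that] M by (auto intro: order.trans[of _ "real M"])
      moreover have "\<bar>?A (n i) - ?A (n j)\<bar> > 3 * \<eta>" if "i < 5" "j < 5" "i \<noteq> j" for i j
        using n(2)[rule_format, OF that] s \<eta> by linarith
      ultimately show False using elim(1) by blast
    qed
  qed
qed

text \<open>The set \<open>P\<close> of primes is fixed before \<open>N\<close> grows, so slow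
  variation replaces the shifted mean at \<open>N / p\<close> by that at \<open>N\<close> for all
  \<open>p \<in> P\<close> simultaneously. Summing with weights \<open>1 / p\<close> and dividing by
  their total \<open>L\<close> leaves \<open>sqrt (2 / L) + \<epsilon> / 2\<close>.\<close>

lemma omega_mean_shift:
  assumes a: "\<And>k. \<bar>a k\<bar> \<le> 1" and \<epsilon>: "0 < \<epsilon>"
  shows "eventually (\<lambda>N. \<bar>omega_mean a (real N) - omega_mean (\<lambda>k. a (Suc k)) (real N)\<bar> \<le> \<epsilon>) sequentially"
proof -
  define a' where "a' = (\<lambda>k. a (Suc k))"
  have a': "\<bar>a' k\<bar> \<le> 1" for k using a by (simp add: a'_def)
  obtain c where c: "c \<ge> 1" "\<And>H. H \<ge> 2 * c \<Longrightarrow> 1 / 4 \<le> (\<Sum>p\<in>prime_block H. 1 / real p)"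
    using prime_block_sums by blast
  \<comment> \<open>Each block contributes at least 1/4, so
    \<open>L \<ge> 8 / \<epsilon>\<^sup>2\<close>, and this is what
    \<open>sqrt (2 * L) \<le> L * (\<epsilon> / 2)\<close> asks for.\<close>
  define m where "m = nat \<lceil>32 / \<epsilon>\<^sup>2\<rceil>"
  have m: "32 / \<epsilon>\<^sup>2 \<le> real m" unfolding m_def by linarith
  define P where "P = prime_blocks (2 * c) m"
  define L where "L = (\<Sum>p\<in>P. 1 / real p)"
  have "real m * (1 / 4) = (\<Sum>r<m. 1 / 4)" by simp
  also have "\<dots> \<le> (\<Sum>r<m. \<Sum>p\<in>prime_block (2 ^ r * (2 * c)). 1 / real p)"
  proof (intro sum_mono c(2))
    fix r :: nat
    have "1 * (2 * c) \<le> 2 ^ r * (2 * c)" using c(1) by (intro mult_right_mono) auto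
    then show "2 * c \<le> 2 ^ r * (2 * c)" by simp
  qed
  also have "\<dots> = L"
    unfolding L_def P_def using c(1) by (intro sum_prime_blocks[symmetric]) auto
  finally have mL: "real m \<le> 4 * L" by simp
  have "0 < 32 / \<epsilon>\<^sup>2" using \<epsilon> by simp
  then have L0: "0 < L" and L_ge: "8 / \<epsilon>\<^sup>2 \<le> L"
    using m mL by linarith+
  have sqrt_L: "sqrt (2 * L) \<le> L * (\<epsilon> / 2)"
  proof (rule real_le_lsqrt)
    have "8 \<le> L * \<epsilon>\<^sup>2" using L_ge \<epsilon> by (simp add: field_simps)
    then have "L * 8 \<le> L * (L * \<epsilon>\<^sup>2)" using L0 by (intro mult_left_mono) auto
    then show "2 * L \<le> (L * (\<epsilon> / 2))\<^sup>2" by (simp add: power2_eq_square field_simps)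
  qed (use L0 \<epsilon> in auto)
  have fP: "finite P" and primeP: "\<And>p. p \<in> P \<Longrightarrow> prime p"
    by (auto simp: P_def dest: prime_prime_blocks)
  \<comment> \<open>Any common upper bound for the primes of \<open>P\<close> serves;
    \<open>Suc\<close> makes its positivity immediate.\<close>
  define X where "X = Suc (\<Sum>P)"
  have X: "0 < p" "p \<le> X" if "p \<in> P" for p
    using primeP[OF that] member_le_sum[OF that, of "\<lambda>x. x"] fP by (auto simp: X_def prime_gt_0_nat)
  obtain N0 where N0: "\<And>N M. N0 \<le> N \<Longrightarrow> N \<le> M \<Longrightarrow> real M \<le> 2 * real X * real N \<Longrightarrow>
      \<bar>omega_mean a' (real M) - omega_mean a' (real N)\<bar> \<le> \<epsilon> / 4"
  proof -
    have "eventually (\<lambda>N. \<forall>M. N \<le> M \<longrightarrow> real M \<le> 2 * real X * real N \<longrightarrow>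
        \<bar>omega_mean a' (real M) - omega_mean a' (real N)\<bar> \<le> \<epsilon> / 4) sequentially"
      using \<epsilon> by (intro omega_mean_slowly_varying a') (simp_all add: X_def sum_nonneg)
    then show ?thesis using that by (auto simp: eventually_sequentially)
  qed
  have "eventually (\<lambda>N. 2 * (real (card P))\<^sup>2 \<le> real N * (\<Sum>p\<in>P. 1 / real p)) sequentially"
    by (rule eventually_card_square_le[OF fP primeP])
  moreover have "eventually (\<lambda>N. N \<ge> X * (N0 + 1) \<and> N \<ge> nat \<lceil>12 * real X / \<epsilon>\<rceil>) sequentially"
    by (intro eventually_conj eventually_ge_at_top)
  ultimately show ?thesis
  proof eventually_elim
    case (elim N)
    have N: "X * (N0 + 1) \<le> N" "12 * real X / \<epsilon> \<le> real N" using elim(2) by (auto simp: nat_ceiling_le_eq)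
    have N_pos: "N > 0" using N(1) by (auto simp: X_def intro!: Nat.gr0I)
    let ?d = "omega_mean a (real N) - omega_mean a' (real N)"
    have near: "\<bar>omega_mean a' (real N / real p) - omega_mean a' (real N)\<bar> \<le> \<epsilon> / 2" if p: "p \<in> P" for p
    proof -
      \<comment> \<open>Slow variation is available at natural arguments, so \<open>N / p\<close> is
        first rounded down to \<open>M\<close>, at a cost of at most
        \<open>3 * X / N\<close>.\<close>
      define M where "M = N div p"
      have "p * (N0 + 1) \<le> N" using X(2)[OF p] N(1) by (meson mult_le_mono1 order.trans)
      then have M: "N0 + 1 \<le> M" using X(1)[OF p] by (simp add: M_def less_eq_div_iff_mult_less_eq mult.commute)
      have MN: "M \<le> N" by (simp add: M_def)
      have y: "real M \<le> real N / real p" "real N / real p \<le> real M + 1"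
        using of_nat_div_bounds[of N p] by (auto simp: M_def)
      have y0: "real N / real p > 0" using N_pos X(1)[OF p] by simp
      have "real N \<le> real p * (real M + 1)" using y(2) X(1)[OF p] by (simp add: field_simps)
      also have "\<dots> \<le> real X * (2 * real M)" using X(2)[OF p] M by (intro mult_mono) auto
      finally have "\<bar>omega_mean a' (real N) - omega_mean a' (real M)\<bar> \<le> \<epsilon> / 4"
        using M MN by (intro N0) auto
      moreover have "\<bar>omega_mean a' (real N / real p) - omega_mean a' (real M)\<bar> \<le> \<epsilon> / 4"
      proof -
        have "\<bar>omega_mean a' (real N / real p) - omega_mean a' (real M)\<bar> \<le>
            2 * (1 - real M / (real N / real p)) + 1 / (real N / real p)"
          using y M by (intro omega_mean_lipschitz[OF a']) auto
        also have "1 - real M / (real N / real p) \<le> 1 / (real N / real p)"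
        proof -
          have "(real N / real p - real M) / (real N / real p) \<le> 1 / (real N / real p)"
            using y y0 by (intro divide_right_mono) auto
          then show ?thesis
            unfolding diff_divide_distrib using y0 by (simp only: divide_self[OF less_imp_neq[OF y0, symmetric]])
        qed
        also have "2 * (1 / (real N / real p)) + 1 / (real N / real p) = 3 * real p / real N" by simp
        also have "\<dots> \<le> 3 * real X / real N"
          using X(2)[OF p] by (intro divide_right_mono) auto
        also have "\<dots> \<le> \<epsilon> / 4" using N(2) N_pos \<epsilon> by (simp add: field_simps)
        finally show ?thesis by simp
      qed
      ultimately show ?thesis by linarith
    qed
    have "L * \<bar>?d\<bar> = (\<Sum>p\<in>P. \<bar>?d\<bar> / real p)"
      by (simp add: L_def sum_distrib_right)
    also have "\<dots> \<le> (\<Sum>p\<in>P. \<bar>omega_mean a' (real N / real p) - omega_mean a (real N)\<bar> / real p + (\<epsilon> / 2) / real p)"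
    proof (rule sum_mono)
      fix p assume p: "p \<in> P"
      have "\<bar>?d\<bar> \<le> \<bar>omega_mean a' (real N / real p) - omega_mean a (real N)\<bar> + \<epsilon> / 2"
        using near[OF p] by linarith
      then show "\<bar>?d\<bar> / real p \<le> \<bar>omega_mean a' (real N / real p) - omega_mean a (real N)\<bar> / real p + (\<epsilon> / 2) / real p"
        unfolding add_divide_distrib[symmetric] by (intro divide_right_mono) auto
    qed
    also have "\<dots> = (\<Sum>p\<in>P. \<bar>omega_mean a' (real N / real p) - omega_mean a (real N)\<bar> / real p) + L * (\<epsilon> / 2)"
      by (simp add: sum.distrib L_def sum_distrib_right)
    also have "(\<Sum>p\<in>P. \<bar>omega_mean a' (real N / real p) - omega_mean a (real N)\<bar> / real p) \<le> sqrt (2 * L)"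
      unfolding a'_def L_def using elim(1) N_pos by (intro omega_mean_prime_shift[OF fP primeP a]) auto
    finally have "L * \<bar>?d\<bar> \<le> L * (\<epsilon> / 2) + L * (\<epsilon> / 2)" using sqrt_L by linarith
    also have "\<dots> = L * \<epsilon>" by simp
    finally have "\<bar>?d\<bar> \<le> \<epsilon>" using L0 by simp
    then show ?case by (simp add: a'_def)
  qed
qed

theorem num_prime_factors_shift_invariant:
  fixes a :: "nat \<Rightarrow> real"
  assumes a: "\<And>k. \<bar>a k\<bar> \<le> 1"
  shows "(\<lambda>N. (\<Sum>n=1..N. a (Suc (num_prime_factors n)) - a (num_prime_factors n)) / real N) \<longlonglongrightarrow> 0"
proof (rule tendstoI)
  fix e :: real assume "e > 0"
  then have "eventually (\<lambda>N. \<bar>omega_mean a (real N) - omega_mean (\<lambda>k. a (Suc k)) (real N)\<bar> \<le> e / 2) sequentially"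
    by (intro omega_mean_shift a) auto
  then show "eventually (\<lambda>N. dist ((\<Sum>n=1..N. a (Suc (num_prime_factors n)) - a (num_prime_factors n)) / real N) 0 < e) sequentially"
  proof eventually_elim
    case (elim N)
    have "(\<Sum>n=1..N. a (Suc (num_prime_factors n)) - a (num_prime_factors n)) / real N =
        omega_mean (\<lambda>k. a (Suc k)) (real N) - omega_mean a (real N)"
      by (simp add: omega_mean_of_nat omega_sum_def sum_subtractf diff_divide_distrib)
    then show ?case using elim \<open>e > 0\<close> by (simp add: dist_norm abs_minus_commute)
  qed
qed

section \<open>Measures from finitely additive limits\<close>

text \<open>Tychonoff's theorem: the functions \<open>h i\<close> lie in a compact cube and have a
  cluster point along \<open>F\<close>. A finer filter takes the place of a subsequence because
  convergence is wanted on all subsets of a space at once, where sequential compactness may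
  fail.\<close>

lemma pointwise_cluster_point:
  fixes h :: "'i \<Rightarrow> 's \<Rightarrow> real"
  assumes h: "\<And>i s. \<bar>h i s\<bar> \<le> 1" and F: "F \<noteq> bot"
  shows "\<exists>G m. G \<noteq> bot \<and> G \<le> F \<and> (\<forall>s. ((\<lambda>i. h i s) \<longlongrightarrow> m s) G)"
proof -
  have "compactin (product_topology (\<lambda>_. euclidean) UNIV) (PiE UNIV (\<lambda>_::'s. {-1..1::real}))"
    by (subst compactin_PiE) auto
  then have "compact (PiE UNIV (\<lambda>_::'s. {-1..1::real}))"
    by (simp add: euclidean_product_topology)
  moreover have "eventually (\<lambda>x. x \<in> PiE UNIV (\<lambda>_. {-1..1})) (filtermap h F)"
    using h by (auto simp: eventually_filtermap abs_le_iff PiE_def Pi_def minus_le_iff)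
  moreover have "filtermap h F \<noteq> bot" using F by (simp add: filtermap_bot_iff)
  ultimately obtain m where m: "inf (nhds m) (filtermap h F) \<noteq> bot"
    unfolding compact_filter by blast
  define G where "G = inf (filtercomap h (nhds m)) F"
  have "G \<noteq> bot"
  proof
    assume "G = bot"
    then have "eventually (\<lambda>_. False) G" by simp
    then obtain P Q where PQ: "eventually P (filtercomap h (nhds m))" "eventually Q F" "\<And>i. P i \<Longrightarrow> Q i \<Longrightarrow> False"
      unfolding G_def eventually_inf by blast
    then obtain R where R: "eventually R (nhds m)" "\<And>i. R (h i) \<Longrightarrow> P i"
      unfolding eventually_filtercomap by blast
    have "eventually (\<lambda>y. \<not> R y) (filtermap h F)"
      unfolding eventually_filtermap using PQ(2) by eventually_elim (use PQ(3) R(2) in blast)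
    then have "eventually (\<lambda>_. False) (inf (nhds m) (filtermap h F))"
      unfolding eventually_inf using R(1) by blast
    then show False using m by (simp add: trivial_limit_def)
  qed
  moreover have "G \<le> F" by (simp add: G_def)
  moreover have "((\<lambda>i. h i s) \<longlongrightarrow> m s) G" for s
  proof -
    have "filterlim h (nhds m) G"
      unfolding G_def by (rule filterlim_mono[OF filterlim_filtercomap order_refl inf_le1])
    moreover have "continuous_on UNIV (\<lambda>x::'s \<Rightarrow> real. x s)"
      by (rule continuous_on_product_coordinates)
    ultimately show ?thesis
      by (auto intro: continuous_on_tendsto_compose[of UNIV "\<lambda>x. x s" h m])
  qed
  ultimately show ?thesis by blast
qed

text \<open>A finitely additive probability on all subsets of a compact metric space, such as a limit of
  empirical measures along an ultrafilter, is regularised to a Borel measure that it dominates on open sets.\<close>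

locale finitely_additive_probability =
  fixes m :: "'a::metric_space set \<Rightarrow> real"
  assumes compact_space: "compact (UNIV :: 'a set)"
    and nonneg: "0 \<le> m A"
    and total: "m UNIV = 1"
    and disjoint_Un: "A \<inter> B = {} \<Longrightarrow> m (A \<union> B) = m A + m B"
begin

lemma empty [simp]: "m {} = 0"
  using disjoint_Un[of "{}" "{}"] by simp

lemma mono: "A \<subseteq> B \<Longrightarrow> m A \<le> m B"
  using disjoint_Un[of A "B - A"] nonneg[of "B - A"] by (simp add: Un_absorb1)

lemma subadditive: "m (A \<union> B) \<le> m A + m B"
  using disjoint_Un[of A "B - A"] mono[of "B - A" B] by simp

lemma le_1: "m A \<le> 1"
  using mono[of A UNIV] total by simp

lemma sum_disjoint:
  assumes "finite I" "disjoint_family_on A I"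
  shows "(\<Sum>i\<in>I. m (A i)) = m (\<Union>i\<in>I. A i)"
  using assms
proof (induction I)
  case (insert i I)
  then have "A i \<inter> (\<Union>i\<in>I. A i) = {}" by (auto simp: disjoint_family_on_def)
  from disjoint_Un[OF this] show ?case using insert by (simp add: disjoint_family_on_def)
qed simp

lemma UN_le_sum: "finite I \<Longrightarrow> m (\<Union>i\<in>I. A i) \<le> (\<Sum>i\<in>I. m (A i))"
proof (induction I rule: finite_induct)
  case (insert i I)
  then show ?case using subadditive[of "A i" "\<Union>i\<in>I. A i"] by simp
qed simp

text \<open>Caratheodory's construction with countable covers. The covers are open because elsewhere
  \<open>m\<close> may disagree with every Borel measure: a limit of point masses may assign 0 to
  the limit point.\<close>

definition outer :: "'a set \<Rightarrow> ennreal" where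
  "outer A = (INF U\<in>{U :: nat \<Rightarrow> 'a set. (\<forall>i. open (U i)) \<and> A \<subseteq> (\<Union>i. U i)}. \<Sum>i. ennreal (m (U i)))"

lemma outer_le_suminf:
  assumes "\<And>i. open (U i)" "A \<subseteq> (\<Union>i. U i)"
  shows "outer A \<le> (\<Sum>i. ennreal (m (U i)))"
  unfolding outer_def using assms by (intro INF_lower) auto

lemma outer_greatest:
  assumes "\<And>U :: nat \<Rightarrow> 'a set. (\<And>i. open (U i)) \<Longrightarrow> A \<subseteq> (\<Union>i. U i) \<Longrightarrow> c \<le> (\<Sum>i. ennreal (m (U i)))"
  shows "c \<le> outer A"
  unfolding outer_def using assms by (intro INF_greatest) auto

lemma outer_mono: "A \<subseteq> B \<Longrightarrow> outer A \<le> outer B"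
  by (intro outer_greatest outer_le_suminf) auto

lemma outer_open_le:
  assumes "open U"
  shows "outer U \<le> ennreal (m U)"
proof -
  let ?U = "\<lambda>i::nat. if i = 0 then U else {}"
  have "outer U \<le> (\<Sum>i. ennreal (m (?U i)))"
    using assms by (intro outer_le_suminf) auto
  also have "\<dots> = (\<Sum>i\<in>{0}. ennreal (m (?U i)))"
    by (intro suminf_finite) auto
  finally show ?thesis by simp
qed

lemma outer_empty [simp]: "outer {} = 0"
  using outer_open_le[of "{}"] by simp

text \<open>Compactness reduces a countable open cover to a finite one, to which finite
  subadditivity of \<open>m\<close> applies. So no mass is lost in the regularisation.\<close>

lemma outer_UNIV: "outer UNIV = 1"
proof (rule antisym)
  show "outer UNIV \<le> 1" using outer_open_le[of UNIV] total by simp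
  show "1 \<le> outer UNIV"
  proof (rule outer_greatest)
    fix U :: "nat \<Rightarrow> 'a set" assume U: "\<And>i. open (U i)" "UNIV \<subseteq> (\<Union>i. U i)"
    obtain I where I: "finite I" "UNIV \<subseteq> (\<Union>i\<in>I. U i)"
      by (rule compactE_image[OF compact_space, of UNIV U]) (use U in auto)
    have "1 = m UNIV" by (simp add: total)
    also have "\<dots> \<le> m (\<Union>i\<in>I. U i)" using I(2) by (rule mono)
    also have "\<dots> \<le> (\<Sum>i\<in>I. m (U i))" using I(1) by (rule UN_le_sum)
    finally have "1 \<le> ennreal (\<Sum>i\<in>I. m (U i))" by (simp add: ennreal_leI flip: ennreal_1)
    also have "\<dots> = (\<Sum>i\<in>I. ennreal (m (U i)))" by (simp add: nonneg sum_ennreal)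
    also have "\<dots> \<le> (\<Sum>i. ennreal (m (U i)))" using I(1) by (intro sum_le_suminf) auto
    finally show "1 \<le> (\<Sum>i. ennreal (m (U i)))" .
  qed
qed

lemma outer_UN_le: "outer (\<Union>n::nat. A n) \<le> (\<Sum>n. outer (A n))"
proof (rule ennreal_le_epsilon)
  fix e :: real assume fin: "(\<Sum>n. outer (A n)) < top" and e: "0 < e"
  have "\<exists>U :: nat \<Rightarrow> 'a set. (\<forall>i. open (U i)) \<and> A n \<subseteq> (\<Union>i. U i) \<and>
      (\<Sum>i. ennreal (m (U i))) < outer (A n) + ennreal (e * (1/2) ^ Suc n)" for n
  proof -
    have "outer (A n) < top" using fin by (rule ennreal_suminf_lessD)
    then have "outer (A n) < outer (A n) + ennreal (e * (1/2) ^ Suc n)"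
      using e by (auto simp: less_top)
    then show ?thesis unfolding outer_def[of "A n"] INF_less_iff by blast
  qed
  then obtain U :: "nat \<Rightarrow> nat \<Rightarrow> 'a set" where U: "\<And>n i. open (U n i)" "\<And>n. A n \<subseteq> (\<Union>i. U n i)"
      "\<And>n. (\<Sum>i. ennreal (m (U n i))) < outer (A n) + ennreal (e * (1/2) ^ Suc n)"
    by metis
  have "outer (\<Union>n. A n) \<le> (\<Sum>k. ennreal (m (case_prod U (prod_decode k))))"
  proof (rule outer_le_suminf)
    show "open (case_prod U (prod_decode k))" for k
      using U(1) by (simp add: case_prod_unfold)
    show "(\<Union>n. A n) \<subseteq> (\<Union>k. case_prod U (prod_decode k))"
    proof
      fix x assume "x \<in> (\<Union>n. A n)"
      then obtain n i where "x \<in> U n i" using U(2) by blast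
      then show "x \<in> (\<Union>k. case_prod U (prod_decode k))"
        by (intro UN_I[of "prod_encode (n, i)"]) auto
    qed
  qed
  also have "\<dots> = (\<Sum>n. \<Sum>i. ennreal (m (U n i)))"
    using suminf_ennreal_2dimen[of "\<lambda>n. \<Sum>i. ennreal (m (U n i))" "\<lambda>(n, i). ennreal (m (U n i))"]
    by (simp add: case_prod_unfold comp_def)
  also have "\<dots> \<le> (\<Sum>n. outer (A n) + ennreal (e * (1/2) ^ Suc n))"
    using U(3) by (intro suminf_le) (auto intro: less_imp_le)
  also have "\<dots> = (\<Sum>n. outer (A n)) + (\<Sum>n. ennreal (e * (1/2) ^ Suc n))"
    by (rule suminf_add[symmetric]) auto
  also have "(\<Sum>n. ennreal (e * (1/2) ^ Suc n)) = ennreal (e * 1)"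
    using e by (intro suminf_ennreal_eq sums_mult power_half_series) auto
  finally show "outer (\<Union>n. A n) \<le> (\<Sum>n. outer (A n)) + ennreal e" by simp
qed

lemma outer_Un_le: "outer (A \<union> B) \<le> outer A + outer B"
proof -
  let ?A = "\<lambda>i::nat. if i = 0 then A else if i = 1 then B else {}"
  have "?A 0 \<subseteq> (\<Union>i. ?A i)" "?A 1 \<subseteq> (\<Union>i. ?A i)" by blast+
  then have "A \<union> B \<subseteq> (\<Union>i. ?A i)" by simp
  then have "outer (A \<union> B) \<le> outer (\<Union>i. ?A i)" by (rule outer_mono)
  also have "\<dots> \<le> (\<Sum>i. outer (?A i))" by (rule outer_UN_le)
  also have "\<dots> = (\<Sum>i\<in>{0,1}. outer (?A i))"
    by (intro suminf_finite) auto
  finally show ?thesis by simp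
qed

text \<open>The set \<open>W = U \<inter> V\<close> is exhausted by the sets of points at distance more than \<open>1/n\<close> from its
  complement; the annuli in between have summable mass, so nothing is lost at the boundary.\<close>

lemma outer_open_split:
  assumes U: "open U" and V: "open V"
  shows "outer (U \<inter> V) + outer (U - V) \<le> ennreal (m U)"
\<comment> \<open>\<open>infdist\<close> to the empty set is 0, so the distance to the complement
  describes \<open>U \<inter> V\<close> only if this complement is nonempty.\<close>
proof (cases "U \<inter> V = UNIV")
  case True
  then have "U = UNIV" "V = UNIV" by auto
  then show ?thesis using outer_open_le[of UNIV] by simp
next
  case False
  define W where "W = U \<inter> V"
  define d where "d = (\<lambda>x. infdist x (- W))"
  have W: "open W" "- W \<noteq> {}" using U V False by (auto simp: W_def)
  have d_cont: "continuous_on UNIV d" unfolding d_def by (intro continuous_intros)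
  have d_pos: "d x > 0 \<longleftrightarrow> x \<in> W" for x
    using in_closed_iff_infdist_zero[of "- W" x] W infdist_nonneg[of x "- W"]
    by (auto simp: d_def closed_Compl less_le)
  \<comment> \<open>The half-open annuli \<open>E k\<close> are disjoint, so their masses sum to at
    most 1. Covers must be open, hence the wider \<open>D k\<close>, each contained in two
    consecutive annuli \<open>E\<close>; their masses are therefore summable as well.\<close>
  define E D where "E = (\<lambda>k::nat. {x. 1 / (real k + 2) \<le> d x \<and> d x < 1 / (real k + 1)})"
    and "D = (\<lambda>k::nat. {x. 1 / (real k + 3) < d x \<and> d x < 1 / (real k + 1)})"
  have open_D: "open (D k)" for k
    unfolding D_def using d_cont
    by (intro open_Collect_conj open_Collect_less continuous_on_const) auto
  have "disjoint_family_on E I" for I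
  proof -
    have "E i \<inter> E j = {}" if "i < j" for i j
    proof -
      have "1 / (real j + 1) \<le> 1 / (real i + 2)" using that by (intro divide_left_mono) auto
      then show ?thesis by (auto simp: E_def)
    qed
    then have "E i \<inter> E j = {}" if "i \<noteq> j" for i j
      using that by (cases i j rule: linorder_cases) (auto simp: Int_commute)
    then show ?thesis by (simp add: disjoint_family_on_def)
  qed
  then have E_sum: "(\<Sum>k\<in>I. m (E k)) \<le> 1" if "finite I" for I
    using that le_1 by (subst sum_disjoint) auto
  have "summable (\<lambda>k. m (E k))"
    by (intro summableI_nonneg_bounded[where x = 1] nonneg E_sum) auto
  then have "summable (\<lambda>k. m (E k) + m (E (Suc k)))"
    by (intro summable_add) (simp_all only: summable_Suc_iff[of "\<lambda>k. m (E k)"])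
  then have D_summable: "summable (\<lambda>k. m (D k))"
  proof (rule summable_comparison_test'[of _ 0])
    fix k :: nat
    have "D k \<subseteq> E k \<union> E (Suc k)" by (auto simp: D_def E_def add_ac)
    then have "m (D k) \<le> m (E k) + m (E (Suc k))" using mono subadditive order.trans by blast
    then show "norm (m (D k)) \<le> m (E k) + m (E (Suc k))" by (simp add: nonneg)
  qed
  have bound: "outer W + outer (U - V) \<le> ennreal (m U + (\<Sum>k. m (D (k + n))))" for n
  proof -
    define A B where "A = {x. 1 / (real n + 2) < d x}" and "B = {x. d x < 1 / (real n + 2)}"
    have AB: "open A" "open B"
      unfolding A_def B_def using d_cont
      by (intro open_Collect_less continuous_on_const; auto)+
    have "A \<subseteq> W"
    proof
      fix x assume "x \<in> A"
      moreover have "0 < 1 / (real n + 2)" by simp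
      ultimately have "0 < d x" unfolding A_def mem_Collect_eq by linarith
      then show "x \<in> W" using d_pos by blast
    qed
    define C where "C = (\<lambda>i. case i of 0 \<Rightarrow> A | Suc k \<Rightarrow> D (k + n))"
    have "outer W \<le> (\<Sum>i. ennreal (m (C i)))"
    proof (rule outer_le_suminf)
      show "open (C i)" for i by (cases i) (auto simp: C_def AB open_D)
      show "W \<subseteq> (\<Union>i. C i)"
      proof
        fix x assume x: "x \<in> W"
        show "x \<in> (\<Union>i. C i)"
        proof (cases "x \<in> A")
          case True
          then show ?thesis by (intro UN_I[of 0]) (auto simp: C_def)
        next
          case False
          have dx: "d x > 0" using x d_pos by blast
          \<comment> \<open>\<open>k + 2\<close> is the ceiling of \<open>1 / d x\<close>, so
            \<open>1 / d x\<close> lies in \<open>(k + 1, k + 2]\<close>; the inequality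
            \<open>n \<le> k\<close> follows from \<open>x\<close> being outside
            \<open>A\<close>.\<close>
          define k where "k = nat (\<lceil>1 / d x\<rceil> - 2)"
          have "real n + 2 \<le> 1 / d x" using False dx by (simp add: A_def field_simps)
          then have k: "n \<le> k" "real k + 1 < 1 / d x" "1 / d x < real k + 3"
            unfolding k_def by linarith+
          then have "x \<in> D k" using dx by (simp add: D_def field_simps)
          then show ?thesis using k(1)
            by (intro UN_I[of "Suc (k - n)"]) (auto simp: C_def)
        qed
      qed
    qed
    also have "\<dots> = ennreal (\<Sum>i. m (C i))"
    proof (rule suminf_ennreal2[OF nonneg])
      show "summable (\<lambda>i. m (C i))"
        using summable_ignore_initial_segment[OF D_summable, of n]
        by (subst summable_Suc_iff[symmetric]) (simp add: C_def)
    qed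
    also have "(\<Sum>i. m (C i)) = m A + (\<Sum>k. m (D (k + n)))"
    proof -
      have "summable (\<lambda>i. m (C i))"
        using summable_ignore_initial_segment[OF D_summable, of n]
        by (subst summable_Suc_iff[symmetric]) (simp add: C_def)
      from suminf_split_head[OF this] show ?thesis by (simp add: C_def)
    qed
    finally have 1: "outer W \<le> ennreal (m A + (\<Sum>k. m (D (k + n))))" .
    have "U - V \<subseteq> U \<inter> B"
    proof
      fix x assume x: "x \<in> U - V"
      then have "\<not> d x > 0" using d_pos by (auto simp: W_def)
      moreover have "0 < 1 / (real n + 2)" by simp
      ultimately have "d x < 1 / (real n + 2)" by linarith
      then show "x \<in> U \<inter> B" using x by (simp add: B_def)
    qed
    then have "outer (U - V) \<le> ennreal (m (U \<inter> B))"
      using outer_mono outer_open_le[of "U \<inter> B"] U AB by (meson open_Int order.trans)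
    moreover have "m A + m (U \<inter> B) \<le> m U"
    proof -
      have "m (A \<union> (U \<inter> B)) = m A + m (U \<inter> B)"
        by (rule disjoint_Un) (auto simp: A_def B_def)
      moreover have "m (A \<union> (U \<inter> B)) \<le> m U"
        using \<open>A \<subseteq> W\<close> by (intro mono) (auto simp: W_def)
      ultimately show ?thesis by simp
    qed
    moreover have "(\<Sum>k. m (D (k + n))) \<ge> 0"
      using summable_ignore_initial_segment[OF D_summable] by (intro suminf_nonneg nonneg)
    ultimately have "outer W + outer (U - V) \<le> ennreal (m A + (\<Sum>k. m (D (k + n)))) + ennreal (m (U \<inter> B))"
      using 1 by (intro add_mono)
    also have "\<dots> = ennreal (m A + (\<Sum>k. m (D (k + n))) + m (U \<inter> B))"
      using \<open>(\<Sum>k. m (D (k + n))) \<ge> 0\<close> by (intro ennreal_plus[symmetric] add_nonneg_nonneg nonneg)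
    also have "\<dots> \<le> ennreal (m U + (\<Sum>k. m (D (k + n))))"
      using \<open>m A + m (U \<inter> B) \<le> m U\<close> by (intro ennreal_leI) simp
    finally show ?thesis .
  qed
  have "(\<lambda>n. ennreal (m U + (\<Sum>k. m (D (k + n))))) \<longlonglongrightarrow> ennreal (m U + 0)"
    by (intro tendsto_ennrealI tendsto_intros suminf_exist_split2 D_summable)
  then have "outer W + outer (U - V) \<le> ennreal (m U + 0)"
    by (rule LIMSEQ_le_const) (use bound in blast)
  then show ?thesis by (simp add: W_def)
qed

text \<open>Applying \<open>outer_open_split\<close> to every member of an open cover shows that
  open sets are Caratheodory measurable, and hence so are all Borel sets.\<close>

lemma measure_space_outer: "measure_space UNIV (sets borel) outer"
proof -
  interpret sigma_algebra UNIV "UNIV :: 'a set set"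
    using sigma_algebra_Pow[of "UNIV :: 'a set"] by simp
  let ?L = "lambda_system UNIV UNIV outer"
  have "outer_measure_space UNIV outer"
    unfolding outer_measure_space_def positive_def increasing_def countably_subadditive_def
    using outer_mono outer_UN_le by auto
  then have L: "measure_space UNIV ?L outer" by (rule caratheodory_lemma)
  then interpret L: sigma_algebra UNIV ?L by (simp add: measure_space_def)
  have "open V \<Longrightarrow> V \<in> ?L" for V
  proof -
    assume V: "open V"
    have "outer (A \<inter> V) + outer (A - V) = outer A" for A
    proof (rule antisym)
      show "outer A \<le> outer (A \<inter> V) + outer (A - V)"
        using outer_Un_le[of "A \<inter> V" "A - V"] by (simp add: Int_Diff_Un)
      show "outer (A \<inter> V) + outer (A - V) \<le> outer A"
      proof (rule outer_greatest)
        fix U :: "nat \<Rightarrow> 'a set" assume U: "\<And>i. open (U i)" "A \<subseteq> (\<Union>i. U i)"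
        have "outer (A \<inter> V) + outer (A - V) \<le> outer (\<Union>i. U i \<inter> V) + outer (\<Union>i. U i - V)"
          using U(2) by (intro add_mono outer_mono) auto
        also have "\<dots> \<le> (\<Sum>i. outer (U i \<inter> V)) + (\<Sum>i. outer (U i - V))"
          by (intro add_mono outer_UN_le)
        also have "\<dots> = (\<Sum>i. outer (U i \<inter> V) + outer (U i - V))"
          by (rule suminf_add) auto
        also have "\<dots> \<le> (\<Sum>i. ennreal (m (U i)))"
          using U(1) V by (intro suminf_le outer_open_split) auto
        finally show "outer (A \<inter> V) + outer (A - V) \<le> (\<Sum>i. ennreal (m (U i)))" .
      qed
    qed
    then show "V \<in> ?L" by (simp add: lambda_system_eq)
  qed
  then have "sets borel \<subseteq> ?L"
    unfolding borel_def by (subst sets_measure_of) (auto intro!: L.sigma_sets_subset)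
  moreover have "countably_additive ?L outer" using L by (simp add: measure_space_def)
  ultimately have "countably_additive (sets borel) outer"
  proof -
    assume sub: "sets borel \<subseteq> ?L" and ca: "countably_additive ?L outer"
    show "countably_additive (sets borel) outer"
      unfolding countably_additive_def
    proof (intro allI impI)
      fix A :: "nat \<Rightarrow> 'a set"
      assume "range A \<subseteq> sets borel" "disjoint_family A" "(\<Union>i. A i) \<in> sets borel"
      then show "(\<Sum>i. outer (A i)) = outer (\<Union>i. A i)"
        using ca[unfolded countably_additive_def, rule_format, of A] sub by auto
    qed
  qed
  moreover have "sigma_algebra UNIV (sets (borel :: 'a measure))"
    using sets.sigma_algebra_axioms[of "borel :: 'a measure"] by simp
  ultimately show ?thesis by (simp add: measure_space_def positive_def)
qed

definition reg :: "'a measure" where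
  "reg = measure_of UNIV (sets borel) outer"

lemma sets_reg [simp, measurable_cong]: "sets reg = sets borel"
  unfolding reg_def using sets.sigma_sets_eq[of borel] by (simp add: sets_measure_of)

lemma space_reg [simp]: "space reg = UNIV"
  by (simp add: reg_def space_measure_of_conv)

lemma emeasure_reg: "A \<in> sets borel \<Longrightarrow> emeasure reg A = outer A"
  unfolding reg_def using measure_space_outer
  by (intro emeasure_measure_of_sigma) (auto simp: measure_space_def)

lemma prob_space_reg: "prob_space reg"
  by (intro prob_spaceI) (simp add: emeasure_reg outer_UNIV)

lemma measure_reg_open_le:
  assumes "open U"
  shows "measure reg U \<le> m U"
proof -
  interpret prob_space reg by (rule prob_space_reg)
  have "ennreal (measure reg U) \<le> ennreal (m U)"
    using outer_open_le[OF assms] assms by (simp add: emeasure_reg flip: emeasure_eq_measure)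
  then show ?thesis by (simp add: nonneg)
qed

text \<open>The preimages of an open cover under the continuous \<open>T\<close> are open and cover
  the preimage, which gives one inequality. The same inequality for the complement gives the other,
  as the total mass is 1.\<close>

lemma invariant_reg:
  assumes T: "continuous_on UNIV T" and inv: "\<And>A. m (T -` A) = m A"
  shows "invariant_prob_measure T reg"
proof -
  interpret prob_space reg by (rule prob_space_reg)
  have T_meas: "T -` A \<in> sets borel" if "A \<in> sets borel" for A
    using measurable_sets[OF borel_measurable_continuous_onI[OF T] that] by simp
  have le: "emeasure reg (T -` A) \<le> emeasure reg A" if A: "A \<in> sets borel" for A
  proof -
    have "outer (T -` A) \<le> outer A"
    proof (rule outer_greatest)
      fix U :: "nat \<Rightarrow> 'a set" assume U: "\<And>i. open (U i)" "A \<subseteq> (\<Union>i. U i)"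
      have "T -` A \<subseteq> (\<Union>i. T -` U i)" using U(2) by blast
      then have "outer (T -` A) \<le> (\<Sum>i. ennreal (m (T -` U i)))"
        using U(1) T by (intro outer_le_suminf open_vimage) auto
      then show "outer (T -` A) \<le> (\<Sum>i. ennreal (m (U i)))" by (simp add: inv)
    qed
    then show ?thesis using A T_meas by (simp add: emeasure_reg)
  qed
  have "emeasure reg (T -` A) = emeasure reg A" if A: "A \<in> sets borel" for A
  proof -
    have "prob (T -` A) \<le> prob A"
      using le[OF A] by (simp add: emeasure_eq_measure)
    moreover have "prob (T -` (- A)) \<le> prob (- A)"
      using le[of "- A"] A by (simp add: emeasure_eq_measure borel_comp)
    moreover have "prob (T -` (- A)) = 1 - prob (T -` A)" "prob (- A) = 1 - prob A"
      using A T_meas prob_compl[of A] prob_compl[of "T -` A"]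
      by (simp_all add: vimage_Compl flip: Compl_eq_Diff_UNIV)
    ultimately show ?thesis by (simp add: emeasure_eq_measure)
  qed
  then show ?thesis
    by (simp add: invariant_prob_measure_def prob_space_reg)
qed

end

section \<open>Averages along a sequence and integrals\<close>

definition empirical :: "(nat \<Rightarrow> 'a) \<Rightarrow> nat \<Rightarrow> 'a set \<Rightarrow> real" where
  "empirical y N A = (\<Sum>n=1..N. indicator A (y n)) / real N"

lemma empirical_bounds: "0 \<le> empirical y N A" "empirical y N A \<le> 1"
proof -
  show "0 \<le> empirical y N A" by (simp add: empirical_def sum_nonneg)
  have "(\<Sum>n=1..N. indicator A (y n)) \<le> (\<Sum>n=1..N. 1 :: real)"
    by (intro sum_mono) (auto simp: indicator_def)
  then show "empirical y N A \<le> 1" by (simp add: empirical_def divide_le_eq)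
qed

text \<open>A discrete layer-cake formula: counting the levels \<open>k / K\<close> strictly below
  \<open>t\<close> recovers \<open>t\<close> up to \<open>1 / K\<close>. With a strict inequality
  the superlevel sets of a continuous function are open.\<close>

lemma layer_sum_bounds:
  fixes t :: real
  assumes t: "0 \<le> t" "t \<le> 1" and K: "K > 0"
  shows "(\<Sum>k=1..K. indicator {s. real k / K < s} t) / K \<le> t"
    and "t \<le> (\<Sum>k=1..K. indicator {s. real k / K < s} t) / K + 1 / K"
proof -
  \<comment> \<open>The number of \<open>k \<ge> 1\<close> with \<open>k / K < t\<close>; at
    \<open>t = 0\<close> the integer is -1 and \<open>nat\<close> turns it into 0.\<close>
  define q where "q = nat (\<lceil>real K * t\<rceil> - 1)"
  have q: "real q \<le> real K * t" "real K * t \<le> real q + 1" "q \<le> K"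
  proof -
    have *: "0 \<le> real K * t" "real K * t \<le> real K * 1" using t by (simp_all add: mult_left_le)
    then have "\<lceil>real K * t\<rceil> \<le> int K" by (simp add: ceiling_le_iff)
    then show "q \<le> K" unfolding q_def by linarith
    show "real q \<le> real K * t" "real K * t \<le> real q + 1" unfolding q_def using * by linarith+
  qed
  have "real k / K < t \<longleftrightarrow> k \<le> q" if "k \<ge> 1" for k
  proof -
    have "real k / K < t \<longleftrightarrow> real k < real K * t" using K by (simp add: divide_less_eq mult.commute)
    also have "\<dots> \<longleftrightarrow> k \<le> q" using that unfolding q_def by linarith
    finally show ?thesis .
  qed
  then have "(\<Sum>k=1..K. indicator {s. real k / K < s} t) = (\<Sum>k=1..K. if k \<le> q then 1 else 0 :: real)"
    by (intro sum.cong) (auto simp: indicator_def)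
  also have "\<dots> = (\<Sum>k=1..q. 1)"
    using q(3) by (intro sum.mono_neutral_cong_right) auto
  finally have eq: "(\<Sum>k=1..K. indicator {s. real k / K < s} t) = real q" by simp
  show "(\<Sum>k=1..K. indicator {s. real k / K < s} t) / K \<le> t"
    unfolding eq using q K by (simp add: divide_le_eq mult.commute)
  show "t \<le> (\<Sum>k=1..K. indicator {s. real k / K < s} t) / K + 1 / K"
    unfolding eq using q K by (simp add: add_divide_distrib[symmetric] le_divide_eq mult.commute)
qed

text \<open>\<open>reg\<close> is at most \<open>m\<close> on the open superlevel sets of
  \<open>f\<close>, so the layer-cake formula yields this one direction.\<close>

lemma (in finitely_additive_probability) integral_reg_less_average:
  fixes f :: "'a \<Rightarrow> real"
  assumes f: "continuous_on UNIV f" "\<And>x. 0 \<le> f x" "\<And>x. f x \<le> 1"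
    and lim: "\<And>A. ((\<lambda>N. empirical y N A) \<longlongrightarrow> m A) G" and e: "e > 0"
  shows "eventually (\<lambda>N. integral\<^sup>L reg f - e < (\<Sum>n=1..N. f (y n)) / real N) G"
proof -
  interpret prob_space reg by (rule prob_space_reg)
  obtain K where K: "K > 0" "1 / real K < e / 2"
    using e real_arch_inverse[of "e / 2"] by (auto simp: inverse_eq_divide)
  define V where "V = (\<lambda>k::nat. {x. real k / K < f x})"
  have openV: "open (V k)" for k
    unfolding V_def using f(1) by (intro open_Collect_less continuous_on_const)
  have Vb: "V k \<in> sets borel" for k using openV by simp
  have ind: "indicator {s. real k / K < s} (f x) = (indicator (V k) x :: real)" for k x
    by (simp add: V_def indicator_def)
  have f_meas: "f \<in> borel_measurable reg"
    using borel_measurable_continuous_onI[OF f(1)] by simp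
  have int_f: "integrable reg f"
    by (rule integrable_const_bound[where B = 1]) (use f f_meas in auto)
  have int_V: "integrable reg (indicat_real (V k))" for k
    using Vb by (intro integrable_real_indicator) (auto simp: less_top[symmetric])
  have prob_UNIV: "prob UNIV = 1" using prob_space by simp
  have "integral\<^sup>L reg f \<le> (\<integral>x. (\<Sum>k=1..K. indicator (V k) x) / K + 1 / K \<partial>reg)"
    using layer_sum_bounds(2)[OF f(2,3) K(1)] Vb
    by (intro integral_mono int_f) (auto simp: ind int_V)
  also have "\<dots> = (\<Sum>k=1..K. prob (V k)) / K + 1 / K"
    using Vb by (simp add: int_V prob_UNIV)
  also have "(\<Sum>k=1..K. prob (V k)) \<le> (\<Sum>k=1..K. m (V k))"
    by (intro sum_mono measure_reg_open_le openV)
  finally have int_le: "integral\<^sup>L reg f \<le> (\<Sum>k=1..K. m (V k)) / K + 1 / K"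
    by (simp add: divide_right_mono)
  have "((\<lambda>N. (\<Sum>k=1..K. empirical y N (V k)) / K) \<longlongrightarrow> (\<Sum>k=1..K. m (V k)) / K) G"
    using K by (intro tendsto_intros lim) auto
  moreover have "(\<Sum>k=1..K. m (V k)) / K - e / 2 < (\<Sum>k=1..K. m (V k)) / K" using e by simp
  ultimately have "eventually (\<lambda>N. (\<Sum>k=1..K. m (V k)) / K - e / 2 < (\<Sum>k=1..K. empirical y N (V k)) / K) G"
    by (rule order_tendstoD)
  then show ?thesis
  proof eventually_elim
    case (elim N)
    have "(\<Sum>k=1..K. empirical y N (V k)) / K = (\<Sum>n=1..N. (\<Sum>k=1..K. indicator (V k) (y n)) / K) / real N"
      unfolding empirical_def sum_divide_distrib[symmetric]
      by (subst sum.swap) (simp add: mult.commute)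
    also have "\<dots> \<le> (\<Sum>n=1..N. f (y n)) / real N"
      using layer_sum_bounds(1)[OF f(2,3) K(1)]
      by (intro divide_right_mono sum_mono) (auto simp: ind)
    finally show ?case using elim int_le K(2) by linarith
  qed
qed

text \<open>The one-sided estimate for \<open>f\<close> bounds the averages from below, and for
  \<open>1 - f\<close> from above.\<close>

lemma (in finitely_additive_probability) averages_tendsto_integral_reg_unit:
  fixes f :: "'a \<Rightarrow> real"
  assumes f: "continuous_on UNIV f" "\<And>x. 0 \<le> f x" "\<And>x. f x \<le> 1"
    and lim: "\<And>A. ((\<lambda>N. empirical y N A) \<longlongrightarrow> m A) G" and G: "G \<le> sequentially"
  shows "((\<lambda>N. (\<Sum>n=1..N. f (y n)) / real N) \<longlongrightarrow> integral\<^sup>L reg f) G"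
proof (rule tendstoI)
  interpret prob_space reg by (rule prob_space_reg)
  fix e :: real assume e: "e > 0"
  have f_meas: "f \<in> borel_measurable reg"
    using borel_measurable_continuous_onI[OF f(1)] by simp
  have int_f: "integrable reg f"
    by (rule integrable_const_bound[where B = 1]) (use f f_meas in auto)
  have int_1: "integral\<^sup>L reg (\<lambda>x. 1 - f x) = 1 - integral\<^sup>L reg f"
    using int_f prob_space by simp
  have "eventually (\<lambda>N. integral\<^sup>L reg f - e < (\<Sum>n=1..N. f (y n)) / real N) G"
    by (rule integral_reg_less_average[OF f lim e])
  moreover have "eventually (\<lambda>N. integral\<^sup>L reg (\<lambda>x. 1 - f x) - e < (\<Sum>n=1..N. 1 - f (y n)) / real N) G"
    using f by (intro integral_reg_less_average lim e continuous_intros) auto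
  moreover have "eventually (\<lambda>N. N > 0) G"
    using G eventually_gt_at_top[of 0] by (auto simp: le_filter_def)
  ultimately show "eventually (\<lambda>N. dist ((\<Sum>n=1..N. f (y n)) / real N) (integral\<^sup>L reg f) < e) G"
  proof eventually_elim
    case (elim N)
    have "(\<Sum>n=1..N. 1 - f (y n)) / real N = 1 - (\<Sum>n=1..N. f (y n)) / real N"
      using elim(3) by (simp add: sum_subtractf diff_divide_distrib)
    then show ?case using elim(1,2) unfolding int_1 dist_real_def by linarith
  qed
qed

lemma (in finitely_additive_probability) averages_tendsto_integral_reg:
  fixes f :: "'a \<Rightarrow> real"
  assumes f: "continuous_on UNIV f"
    and lim: "\<And>A. ((\<lambda>N. empirical y N A) \<longlongrightarrow> m A) G" and G: "G \<le> sequentially"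
  shows "((\<lambda>N. (\<Sum>n=1..N. f (y n)) / real N) \<longlongrightarrow> integral\<^sup>L reg f) G"
proof -
  interpret prob_space reg by (rule prob_space_reg)
  obtain b where b: "\<And>x. \<bar>f x\<bar> \<le> b"
    using compact_imp_bounded[OF compact_continuous_image[OF f compact_space]]
    by (auto simp: bounded_iff)
  define B where "B = b + 1"
  have B: "B > 0" "\<And>x. \<bar>f x\<bar> \<le> B" using b 
  proof -
    have "0 \<le> b" using b[of undefined] by linarith
    then show "B > 0" by (simp add: B_def)
    show "\<bar>f x\<bar> \<le> B" for x using b[of x] by (simp add: B_def)
  qed
  define g where "g = (\<lambda>x. (f x + B) / (2 * B))"
  have g: "continuous_on UNIV g" "\<And>x. 0 \<le> g x" "\<And>x. g x \<le> 1"
  proof -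
    show "continuous_on UNIV g" unfolding g_def using B by (intro continuous_intros f) auto
    show "0 \<le> g x" "g x \<le> 1" for x using B(1) B(2)[of x] by (auto simp: g_def abs_le_iff)
  qed
  have f_eq: "f = (\<lambda>x. 2 * B * g x - B)" using B by (auto simp: g_def fun_eq_iff)
  have g_meas: "g \<in> borel_measurable reg"
    using borel_measurable_continuous_onI[OF g(1)] by simp
  have int_g: "integrable reg g"
    by (rule integrable_const_bound[where B = 1]) (use g g_meas in auto)
  have "((\<lambda>N. 2 * B * ((\<Sum>n=1..N. g (y n)) / real N) - B) \<longlongrightarrow> 2 * B * integral\<^sup>L reg g - B) G"
    by (intro tendsto_intros averages_tendsto_integral_reg_unit[OF g lim G])
  also have "2 * B * integral\<^sup>L reg g - B = integral\<^sup>L reg f"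
    unfolding f_eq using int_g prob_space by simp
  finally have "((\<lambda>N. 2 * B * ((\<Sum>n=1..N. g (y n)) / real N) - B) \<longlongrightarrow> integral\<^sup>L reg f) G" .
  moreover have "eventually (\<lambda>N. 2 * B * ((\<Sum>n=1..N. g (y n)) / real N) - B = (\<Sum>n=1..N. f (y n)) / real N) G"
  proof -
    have "eventually (\<lambda>N. N > 0) G"
      using G eventually_gt_at_top[of 0] by (auto simp: le_filter_def)
    then show ?thesis
    proof eventually_elim
      case (elim N)
      have "(\<Sum>n=1..N. f (y n)) = 2 * B * (\<Sum>n=1..N. g (y n)) - real N * B"
        by (subst f_eq) (simp add: sum_subtractf sum_distrib_left)
      then show ?case using elim by (simp add: diff_divide_distrib)
    qed
  qed
  ultimately show ?thesis by (rule Lim_transform_eventually)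
qed

text \<open>The sequence \<open>y\<close> is arbitrary: what matters is that its empirical measures
  are asymptotically invariant. It will be the orbit sampled at
  \<open>num_prime_factors n\<close>.\<close>

theorem uniquely_ergodic_averages:
  fixes T :: "'a::metric_space \<Rightarrow> 'a" and f :: "'a \<Rightarrow> real" and y :: "nat \<Rightarrow> 'a"
  assumes X: "compact (UNIV :: 'a set)" and T: "continuous_on UNIV T"
    and unique: "uniquely_ergodic T" and \<mu>: "invariant_prob_measure T \<mu>"
    and f: "continuous_on UNIV f"
    and inv: "\<And>A. (\<lambda>N. empirical y N (T -` A) - empirical y N A) \<longlonglongrightarrow> 0"
  shows "(\<lambda>N. (\<Sum>n=1..N. f (y n)) / real N) \<longlonglongrightarrow> integral\<^sup>L \<mu> f"
proof (rule ccontr)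
  let ?av = "\<lambda>N. (\<Sum>n=1..N. f (y n)) / real N"
  assume "\<not> ?av \<longlonglongrightarrow> integral\<^sup>L \<mu> f"
  then obtain e where e: "e > 0" "\<not> eventually (\<lambda>N. dist (?av N) (integral\<^sup>L \<mu> f) < e) sequentially"
    unfolding tendsto_iff by blast
  \<comment> \<open>Restricts to the \<open>N\<close> whose average is at least \<open>e\<close>
    away from the integral, so that no proper refinement of this filter can make the averages
    converge to it.\<close>
  define F where "F = inf sequentially (principal {N. \<not> dist (?av N) (integral\<^sup>L \<mu> f) < e})"
  have "F \<noteq> bot"
  proof
    assume "F = bot"
    then have "eventually (\<lambda>_. False) F" by simp
    then show False using e(2) unfolding F_def eventually_inf_principal by simp
  qed
  moreover have "\<bar>empirical y N A\<bar> \<le> 1" for N A using empirical_bounds[of y N A] by simp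
  ultimately obtain G m where G: "G \<noteq> bot" "G \<le> F" and lim: "\<And>A. ((\<lambda>N. empirical y N A) \<longlongrightarrow> m A) G"
    using pointwise_cluster_point[of "empirical y" F] by blast
  have Gseq: "G \<le> sequentially" using G(2) by (simp add: F_def)
  have pos: "eventually (\<lambda>N. N > 0) G"
    using Gseq eventually_gt_at_top[of 0] by (auto simp: le_filter_def)
  interpret finitely_additive_probability m
  proof
    show "compact (UNIV :: 'a set)" by (rule X)
    show "0 \<le> m A" for A
      by (rule tendsto_lowerbound[OF lim always_eventually G(1)]) (simp add: empirical_bounds)
    have "eventually (\<lambda>N. empirical y N UNIV = 1) G"
      using pos by eventually_elim (simp add: empirical_def)
    then have "((\<lambda>N. empirical y N UNIV) \<longlongrightarrow> 1) G" by (rule tendsto_eventually)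
    with lim[of UNIV] show "m UNIV = 1" by (rule tendsto_unique[OF G(1)])
    show "m (A \<union> B) = m A + m B" if "A \<inter> B = {}" for A B
    proof -
      have "empirical y N (A \<union> B) = empirical y N A + empirical y N B" for N
        using that by (simp add: empirical_def indicator_add[symmetric] sum.distrib add_divide_distrib)
      then have "((\<lambda>N. empirical y N (A \<union> B)) \<longlongrightarrow> m A + m B) G"
        using tendsto_add[OF lim[of A] lim[of B]] by simp
      with lim[of "A \<union> B"] show ?thesis by (rule tendsto_unique[OF G(1)])
    qed
  qed
  have "m (T -` A) = m A" for A
  proof -
    have "((\<lambda>N. empirical y N (T -` A) - empirical y N A) \<longlongrightarrow> 0) G"
      using inv Gseq by (rule filterlim_mono[OF _ order_refl])
    with tendsto_diff[OF lim[of "T -` A"] lim[of A]] have "m (T -` A) - m A = 0"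
      by (rule tendsto_unique[OF G(1)])
    then show ?thesis by simp
  qed
  then have "invariant_prob_measure T reg" by (rule invariant_reg[OF T])
  then have "reg = \<mu>" using unique \<mu> by (auto simp: uniquely_ergodic_def)
  then have "eventually (\<lambda>N. dist (?av N) (integral\<^sup>L \<mu> f) < e) G"
    using averages_tendsto_integral_reg[OF f lim Gseq] e(1) by (auto dest: tendstoD)
  moreover have "eventually (\<lambda>N. \<not> dist (?av N) (integral\<^sup>L \<mu> f) < e) G"
  proof -
    have "eventually (\<lambda>N. \<not> dist (?av N) (integral\<^sup>L \<mu> f) < e) F"
      unfolding F_def eventually_inf_principal by simp
    then show ?thesis using G(2) by (simp add: le_filter_def)
  qed
  ultimately have "eventually (\<lambda>_. False) G" by eventually_elim simp
  then show False using G(1) by (simp add: trivial_limit_def)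
qed

section \<open>Squarefree numbers\<close>

lemma num_prime_factors_mult:
  "a > 0 \<Longrightarrow> b > 0 \<Longrightarrow> num_prime_factors (a * b) = num_prime_factors a + num_prime_factors b"
  by (simp add: num_prime_factors_def prime_factorization_mult)

theorem averages_along_num_prime_factors:
  fixes T :: "'a::metric_space \<Rightarrow> 'a" and f :: "'a \<Rightarrow> complex"
  assumes X: "compact (UNIV :: 'a set)" and T: "continuous_on UNIV T"
    and unique: "uniquely_ergodic T" and \<mu>: "invariant_prob_measure T \<mu>"
    and f: "continuous_on UNIV f"
  shows "(\<lambda>N. (\<Sum>n=1..N. f ((T ^^ num_prime_factors n) x)) / of_nat N) \<longlonglongrightarrow> (\<integral>y. f y \<partial>\<mu>)"
proof -
  define y where "y = (\<lambda>n. (T ^^ num_prime_factors n) x)"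
  have "(\<lambda>N. empirical y N (T -` A) - empirical y N A) \<longlonglongrightarrow> 0" for A
  proof -
    \<comment> \<open>Records the visits of the orbit to an arbitrary set \<open>A\<close>; the
      visits to the preimage of \<open>A\<close> under \<open>T\<close> are the shift of
      \<open>a\<close>.\<close>
    define a :: "nat \<Rightarrow> real" where "a = (\<lambda>k. indicator A ((T ^^ k) x))"
    have "(\<lambda>N. (\<Sum>n=1..N. a (Suc (num_prime_factors n)) - a (num_prime_factors n)) / real N) \<longlonglongrightarrow> 0"
      by (rule num_prime_factors_shift_invariant) (simp add: a_def indicator_def)
    then show ?thesis
      by (simp add: empirical_def a_def y_def indicator_def sum_subtractf diff_divide_distrib)
  qed
  note real_case = uniquely_ergodic_averages[OF X T unique \<mu> _ this]
  have Re: "(\<lambda>N. (\<Sum>n=1..N. Re (f (y n))) / real N) \<longlonglongrightarrow> (\<integral>y. Re (f y) \<partial>\<mu>)"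
    by (intro real_case continuous_intros f)
  have Im: "(\<lambda>N. (\<Sum>n=1..N. Im (f (y n))) / real N) \<longlonglongrightarrow> (\<integral>y. Im (f y) \<partial>\<mu>)"
    by (intro real_case continuous_intros f)
  have int_f: "integrable \<mu> f"
  proof -
    interpret prob_space \<mu> using \<mu> by (simp add: invariant_prob_measure_def)
    have "sets \<mu> = sets borel" using \<mu> by (simp add: invariant_prob_measure_def)
    then have "f \<in> borel_measurable \<mu>"
      using borel_measurable_continuous_onI[OF f] by (simp cong: measurable_cong_sets)
    moreover obtain B where "\<And>x. norm (f x) \<le> B"
      using compact_imp_bounded[OF compact_continuous_image[OF f X]] by (auto simp: bounded_iff)
    ultimately show ?thesis by (intro integrable_const_bound[where B = B]) auto
  qed
  show ?thesis
    using Re Im int_f by (simp add: tendsto_complex_iff y_def)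
qed

text \<open>Tannery's theorem, that is, dominated convergence for series; the terms vanish for
  \<open>N \<le> k\<close>, so each finite sum is a full series.\<close>

lemma tendsto_triangular_sum:
  fixes u :: "nat \<Rightarrow> nat \<Rightarrow> 'a::{real_normed_algebra, banach}"
  assumes lim: "\<And>k. (\<lambda>N. u k N) \<longlonglongrightarrow> b k" and bound: "\<And>k N. norm (u k N) \<le> M k"
    and M: "summable M" and zero: "\<And>k N. N \<le> k \<Longrightarrow> u k N = 0"
  shows "(\<lambda>N. \<Sum>k<N. u k N) \<longlonglongrightarrow> suminf b"
proof -
  have "(\<lambda>N. \<Sum>k. u k N) \<longlonglongrightarrow> suminf b"
    using tannerys_theorem[of u b sequentially M, OF lim _ M sequentially_bot] bound
    by (simp add: always_eventually)
  moreover have "(\<Sum>k. u k N) = (\<Sum>k<N. u k N)" for N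
    by (rule suminf_finite) (auto simp: zero)
  ultimately show ?thesis by simp
qed

lemma summable_inverse_squares_Suc: "summable (\<lambda>k. 1 / (real (Suc k))\<^sup>2)"
  using sums_summable[OF inverse_squares_sums] by (simp add: add.commute)

text \<open>A finite form of the inversion of zeta(2): with weights \<open>Z (N div d)\<close> the
  sum of \<open>moebius_mu d / d^2\<close> is exactly 1 for every \<open>N > 0\<close>, because the
  convolution of the Moebius function with 1 is trivial. Letting \<open>N\<close> grow turns each
  weight into \<open>pi^2 / 6\<close>.\<close>

lemma suminf_moebius_over_squares: "(\<Sum>k. moebius_mu (Suc k) / (real (Suc k))\<^sup>2) = 6 / pi\<^sup>2"
proof -
  define Z where "Z = (\<lambda>M. \<Sum>m=1..M. 1 / (real m)\<^sup>2)"
  have Z_eq: "Z M = (\<Sum>k<M. 1 / (real (Suc k))\<^sup>2)" for M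
    unfolding Z_def by (simp only: One_nat_def sum.atLeast1_atMost_eq)
  have sums: "(\<lambda>k. 1 / (real (Suc k))\<^sup>2) sums (pi\<^sup>2 / 6)"
    using inverse_squares_sums by (simp add: add.commute)
  have Z_lim: "Z \<longlonglongrightarrow> pi\<^sup>2 / 6"
    using sums unfolding sums_def Z_eq by simp
  have Z_bound: "\<bar>Z M\<bar> \<le> pi\<^sup>2 / 6" for M
    using sum_le_suminf[OF sums_summable[OF sums], of "{..<M}"] sums_unique[OF sums]
    unfolding Z_eq by (simp add: sum_nonneg)
  have one: "(\<Sum>k<N. moebius_mu (Suc k) / (real (Suc k))\<^sup>2 * Z (N div Suc k)) = 1" if N: "N > 0" for N
  proof -
    have "(\<Sum>k<N. moebius_mu (Suc k) / (real (Suc k))\<^sup>2 * Z (N div Suc k)) =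
        (\<Sum>d=1..N. moebius_mu d / (real d)\<^sup>2 * Z (N div d))"
      by (simp only: One_nat_def sum.atLeast1_atMost_eq)
    also have "\<dots> = (\<Sum>d=1..N. \<Sum>m=1..N div d. moebius_mu d / (real (d * m))\<^sup>2)"
      by (simp add: Z_def sum_distrib_left power_mult_distrib)
    also have "\<dots> = (\<Sum>n=1..N. \<Sum>d | d dvd n. moebius_mu d / (real (d * (n div d)))\<^sup>2)"
      by (rule sum_over_divisor_pairs[symmetric])
    also have "\<dots> = (\<Sum>n=1..N. (\<Sum>d | d dvd n. moebius_mu d) / (real n)\<^sup>2)"
      unfolding sum_divide_distrib by (intro sum.cong refl) (simp add: dvd_mult_div_cancel)
    also have "\<dots> = (\<Sum>n=1..N. if n = 1 then 1 else 0)"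
      by (intro sum.cong refl) (auto simp: sum_moebius_dvd)
    also have "\<dots> = 1" using N by (subst sum.delta) auto
    finally show ?thesis .
  qed
  have "(\<lambda>N. \<Sum>k<N. moebius_mu (Suc k) / (real (Suc k))\<^sup>2 * Z (N div Suc k))
      \<longlonglongrightarrow> (\<Sum>k. moebius_mu (Suc k) / (real (Suc k))\<^sup>2 * (pi\<^sup>2 / 6))"
  proof (rule tendsto_triangular_sum)
    fix k
    have "filterlim (\<lambda>N. N div Suc k) sequentially sequentially"
      by (rule filterlim_at_top_div_const_nat) simp
    then show "(\<lambda>N. moebius_mu (Suc k) / (real (Suc k))\<^sup>2 * Z (N div Suc k))
        \<longlonglongrightarrow> moebius_mu (Suc k) / (real (Suc k))\<^sup>2 * (pi\<^sup>2 / 6)"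
      by (intro tendsto_mult_left filterlim_compose[OF Z_lim])
    show "norm (moebius_mu (Suc k) / (real (Suc k))\<^sup>2 * Z (N div Suc k)) \<le> pi\<^sup>2 / 6 * (1 / (real (Suc k))\<^sup>2)" for N
    proof -
      have "norm (moebius_mu (Suc k) / (real (Suc k))\<^sup>2 * Z (N div Suc k)) =
          \<bar>moebius_mu (Suc k)\<bar> * \<bar>Z (N div Suc k)\<bar> * (1 / (real (Suc k))\<^sup>2)"
        by (simp add: abs_mult)
      also have "\<dots> \<le> 1 * (pi\<^sup>2 / 6) * (1 / (real (Suc k))\<^sup>2)"
        by (intro mult_right_mono mult_mono abs_moebius_le Z_bound) auto
      finally show ?thesis by simp
    qed
    show "moebius_mu (Suc k) / (real (Suc k))\<^sup>2 * Z (N div Suc k) = 0" if "N \<le> k" for N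
      using that by (simp add: Z_def)
  qed (intro summable_mult summable_inverse_squares_Suc)
  moreover have "(\<lambda>N. \<Sum>k<N. moebius_mu (Suc k) / (real (Suc k))\<^sup>2 * Z (N div Suc k)) \<longlonglongrightarrow> 1"
    by (rule tendsto_eventually) (use one in \<open>auto intro: eventually_mono[OF eventually_gt_at_top[of 0]]\<close>)
  ultimately have "(\<Sum>k. moebius_mu (Suc k) / (real (Suc k))\<^sup>2 * (pi\<^sup>2 / 6)) = 1"
    by (rule LIMSEQ_unique)
  moreover have "summable (\<lambda>k. moebius_mu (Suc k) / (real (Suc k))\<^sup>2)"
    by (rule summable_comparison_test'[OF summable_inverse_squares_Suc, of 0])
      (use abs_moebius_le in \<open>auto simp: intro!: divide_right_mono\<close>)
  ultimately have "(\<Sum>k. moebius_mu (Suc k) / (real (Suc k))\<^sup>2) * (pi\<^sup>2 / 6) = 1"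
    by (simp only: suminf_mult2)
  then show ?thesis by (simp add: field_simps)
qed

section \<open>Detection of squarefree numbers by square divisors\<close>

lemma squarefree_iff_square_part: "n > 0 \<Longrightarrow> squarefree n \<longleftrightarrow> square_part (n :: nat) = 1"
  unfolding squarefree_def dvd_square_part_iff[symmetric] by (metis dvd_refl nat_dvd_1_iff_1)

text \<open>\<open>d^2\<close> divides \<open>n\<close> exactly if \<open>d\<close> divides
  \<open>square_part n\<close>, so this is the full Moebius divisor sum of
  \<open>square_part n\<close>, which equals 1 for squarefree \<open>n\<close>.\<close>

lemma sum_moebius_square_dvd:
  fixes n :: nat
  assumes n: "1 \<le> n" "n \<le> N"
  shows "(\<Sum>d=1..N. of_bool (d\<^sup>2 dvd n) * moebius_mu d) = of_bool (squarefree n)"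
proof -
  have sp: "square_part n > 0" using n by (intro Nat.gr0I) auto
  have le: "d \<le> N" if "d\<^sup>2 dvd n" for d
  proof -
    have "d \<le> d\<^sup>2" by (simp add: power2_eq_square)
    also have "\<dots> \<le> n" using that n by (intro dvd_imp_le) auto
    finally show ?thesis using n by simp
  qed
  have "(\<Sum>d=1..N. of_bool (d\<^sup>2 dvd n) * moebius_mu d) = (\<Sum>d | d dvd square_part n. moebius_mu d)"
    using sp le by (intro sum.mono_neutral_cong_right)
      (auto simp: dvd_square_part_iff Suc_le_eq intro!: Nat.gr0I dest: le)
  also have "\<dots> = of_bool (squarefree n)"
    using n sp by (simp add: sum_moebius_dvd squarefree_iff_square_part)
  finally show ?thesis .
qed

lemma sum_squarefree_eq:
  fixes F :: "nat \<Rightarrow> complex"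
  shows "(\<Sum>n | 1 \<le> n \<and> n \<le> N \<and> squarefree n. F n) =
    (\<Sum>d=1..N. of_real (moebius_mu d) * (\<Sum>m=1..N div d\<^sup>2. F (d\<^sup>2 * m)))"
proof -
  have "(\<Sum>n | 1 \<le> n \<and> n \<le> N \<and> squarefree n. F n) = (\<Sum>n=1..N. of_bool (squarefree n) * F n)"
    by (intro sum.mono_neutral_cong_left) auto
  also have "\<dots> = (\<Sum>n=1..N. \<Sum>d=1..N. of_real (moebius_mu d) * (of_bool (d\<^sup>2 dvd n) * F n))"
  proof (rule sum.cong[OF refl])
    fix n assume "n \<in> {1..N}"
    then have "of_bool (squarefree n) = (of_real (\<Sum>d=1..N. of_bool (d\<^sup>2 dvd n) * moebius_mu d) :: complex)"
      by (subst sum_moebius_square_dvd) auto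
    then show "of_bool (squarefree n) * F n = (\<Sum>d=1..N. of_real (moebius_mu d) * (of_bool (d\<^sup>2 dvd n) * F n))"
      by (simp only: of_real_sum sum_distrib_right) (intro sum.cong refl, simp add: of_bool_def)
  qed
  also have "\<dots> = (\<Sum>d=1..N. of_real (moebius_mu d) * (\<Sum>n=1..N. of_bool (d\<^sup>2 dvd n) * F n))"
    by (subst sum.swap) (simp only: sum_distrib_left)
  also have "\<dots> = (\<Sum>d=1..N. of_real (moebius_mu d) * (\<Sum>m=1..N div d\<^sup>2. F (d\<^sup>2 * m)))"
    by (intro sum.cong refl arg_cong2[where f = "(*)"] sum_of_bool_dvd) auto
  finally show ?thesis .
qed

text \<open>After the sieve the term of \<open>d\<close> is an orbit sum of length
  \<open>N div d^2\<close>, divided by \<open>N\<close>. It tends to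
  \<open>moebius_mu d / d^2\<close> times the integral and is dominated by \<open>B / d^2\<close>,
  so the limit can be taken term by term.\<close>

theorem corollary1p8:
  fixes T :: "'a::metric_space \<Rightarrow> 'a"
    and \<mu> :: "'a measure"
    and f :: "'a \<Rightarrow> complex"
    and x :: 'a
  assumes compact_space: "compact (UNIV :: 'a set)"
    and continuous_T: "continuous_on UNIV T"
    and unique: "uniquely_ergodic T"
    and invariant: "invariant_prob_measure T \<mu>"
    and continuous_f: "continuous_on UNIV f"
  shows "(\<lambda>N::nat. 1 / of_nat N *
            (\<Sum>n | 1 \<le> n \<and> n \<le> N \<and> squarefree n. f ((T ^^ num_prime_factors n) x)))
         \<longlonglongrightarrow> 6 / (of_real pi)\<^sup>2 * (\<integral>y. f y \<partial>\<mu>)"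
proof -
  let ?I = "\<integral>y. f y \<partial>\<mu>"
  obtain B where B: "\<And>z. norm (f z) \<le> B"
    using compact_imp_bounded[OF compact_continuous_image[OF continuous_f compact_space]]
    by (auto simp: bounded_iff)
  \<comment> \<open>The modified starting point absorbs the prime factors of \<open>d^2\<close> in
    \<open>n = d^2 * m\<close>.\<close>
  define S where "S = (\<lambda>d M. \<Sum>m=1..M. f ((T ^^ num_prime_factors m) ((T ^^ num_prime_factors (d\<^sup>2)) x)))"
  define u where "u = (\<lambda>k N. of_real (moebius_mu (Suc k)) * (S (Suc k) (N div (Suc k)\<^sup>2) / of_nat N))"
  have S_bound: "norm (S d M) \<le> real M * B" for d M
    unfolding S_def using B by (intro order.trans[OF norm_sum] order.trans[OF sum_bounded_above[of _ _ B]]) auto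
  have ratio: "(\<lambda>N. real (N div d) / real N) \<longlonglongrightarrow> 1 / real d" if "d > 0" for d :: nat
  proof (rule tendsto_sandwich)
    show "eventually (\<lambda>N. 1 / real d - 1 / real N \<le> real (N div d) / real N) sequentially"
      using eventually_gt_at_top[of 0]
    proof eventually_elim
      case (elim N)
      have "(real N / real d - 1) / real N \<le> real (N div d) / real N"
        by (intro divide_right_mono of_nat_div_bounds) auto
      then show ?case using elim by (simp add: diff_divide_distrib)
    qed
    show "eventually (\<lambda>N. real (N div d) / real N \<le> 1 / real d) sequentially"
      using eventually_gt_at_top[of 0]
    proof eventually_elim
      case (elim N)
      have "real (N div d) / real N \<le> real N / real d / real N"
        by (intro divide_right_mono of_nat_div_bounds) auto
      then show ?case using elim by simp
    qed
    show "(\<lambda>N. 1 / real d - 1 / real N) \<longlonglongrightarrow> 1 / real d"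
      using tendsto_diff[OF tendsto_const lim_1_over_n, of "1 / real d"] by simp
  qed simp
  have "1 / of_nat N * (\<Sum>n | 1 \<le> n \<and> n \<le> N \<and> squarefree n. f ((T ^^ num_prime_factors n) x)) =
      (\<Sum>k<N. u k N)" for N
  proof -
    have "(\<Sum>n | 1 \<le> n \<and> n \<le> N \<and> squarefree n. f ((T ^^ num_prime_factors n) x)) =
        (\<Sum>d=1..N. of_real (moebius_mu d) * (\<Sum>m=1..N div d\<^sup>2. f ((T ^^ num_prime_factors (d\<^sup>2 * m)) x)))"
      by (rule sum_squarefree_eq)
    also have "\<dots> = (\<Sum>d=1..N. of_real (moebius_mu d) * S d (N div d\<^sup>2))"
      unfolding S_def
      by (intro sum.cong refl arg_cong2[where f = "(*)"])
        (simp add: num_prime_factors_mult funpow_add add.commute[of "num_prime_factors (_ ^ 2)"])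
    also have "\<dots> = (\<Sum>k<N. of_real (moebius_mu (Suc k)) * S (Suc k) (N div (Suc k)\<^sup>2))"
      by (simp only: One_nat_def sum.atLeast1_atMost_eq)
    finally show ?thesis by (simp add: u_def sum_distrib_left)
  qed
  moreover have "(\<lambda>N. \<Sum>k<N. u k N) \<longlonglongrightarrow> (\<Sum>k. of_real (moebius_mu (Suc k) / (real (Suc k))\<^sup>2) * ?I)"
  proof (rule tendsto_triangular_sum)
    fix k
    define d where "d = (Suc k)\<^sup>2"
    have d: "d > 0" by (simp add: d_def)
    have "(\<lambda>M. S (Suc k) M / of_nat M) \<longlonglongrightarrow> ?I"
      unfolding S_def by (rule averages_along_num_prime_factors) fact+
    then have "(\<lambda>N. S (Suc k) (N div d) / of_nat (N div d)) \<longlonglongrightarrow> ?I"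
      by (rule filterlim_compose) (rule filterlim_at_top_div_const_nat[OF d])
    then have "(\<lambda>N. of_real (moebius_mu (Suc k)) * (S (Suc k) (N div d) / of_nat (N div d) * of_real (real (N div d) / real N)))
        \<longlonglongrightarrow> of_real (moebius_mu (Suc k)) * (?I * of_real (1 / real d))"
      by (intro tendsto_mult tendsto_const tendsto_of_real ratio d)
    \<comment> \<open>For \<open>N div d = 0\<close> both sides are 0: the orbit sum is
      empty.\<close>
    moreover have "of_real (moebius_mu (Suc k)) * (S (Suc k) (N div d) / of_nat (N div d) * of_real (real (N div d) / real N)) = u k N" for N
      by (cases "N div d = 0") (simp_all add: u_def d_def S_def)
    ultimately show "(\<lambda>N. u k N) \<longlonglongrightarrow> of_real (moebius_mu (Suc k) / (real (Suc k))\<^sup>2) * ?I"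
      by (simp add: d_def field_simps)
    show "norm (u k N) \<le> B * (1 / (real (Suc k))\<^sup>2)" for N
    proof (cases "N = 0")
      case True
      moreover have "B \<ge> 0" using B[of x] norm_ge_zero[of "f x"] by linarith
      ultimately show ?thesis by (simp add: u_def)
    next
      case False
      have B0: "B \<ge> 0" using B[of x] norm_ge_zero[of "f x"] by linarith
      have "norm (u k N) = \<bar>moebius_mu (Suc k)\<bar> * (norm (S (Suc k) (N div d)) / real N)"
        by (simp add: u_def d_def norm_mult norm_divide)
      also have "\<dots> \<le> 1 * (real (N div d) * B / real N)"
        by (intro mult_mono abs_moebius_le divide_right_mono S_bound) auto
      also have "\<dots> \<le> 1 * (real N / real d * B / real N)"
        using B0 by (intro mult_left_mono divide_right_mono mult_right_mono of_nat_div_bounds) auto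
      also have "\<dots> = B * (1 / (real (Suc k))\<^sup>2)" using False by (simp add: d_def)
      finally show ?thesis .
    qed
    show "u k N = 0" if "N \<le> k" for N
    proof -
      have "N < Suc k" using that by simp
      also have "Suc k \<le> d" by (simp add: d_def power2_eq_square)
      finally show ?thesis by (simp add: u_def d_def[symmetric] S_def)
    qed
  qed (intro summable_mult summable_inverse_squares_Suc)
  moreover have "(\<Sum>k. of_real (moebius_mu (Suc k) / (real (Suc k))\<^sup>2) * ?I) = 6 / (of_real pi)\<^sup>2 * ?I"
  proof -
    have sm: "summable (\<lambda>k. moebius_mu (Suc k) / (real (Suc k))\<^sup>2)"
      by (rule summable_comparison_test'[OF summable_inverse_squares_Suc, of 0])
        (use abs_moebius_le in \<open>auto intro!: divide_right_mono\<close>)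
    have "(\<Sum>k. of_real (moebius_mu (Suc k) / (real (Suc k))\<^sup>2) * ?I) =
        (\<Sum>k. of_real (moebius_mu (Suc k) / (real (Suc k))\<^sup>2)) * ?I"
      using summable_of_real[OF sm] by (rule suminf_mult2[symmetric])
    also have "(\<Sum>k. of_real (moebius_mu (Suc k) / (real (Suc k))\<^sup>2)) = (of_real (6 / pi\<^sup>2) :: complex)"
      unfolding suminf_moebius_over_squares[symmetric] by (rule suminf_of_real[OF sm, symmetric])
    finally show ?thesis by simp
  qed
  ultimately show ?thesis by simp
qed

end
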